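(* Let $\psi:\mathbb{N}\to(0,1]$ be any function. For $k\in\mathbb{N}$ let \[ S_k=\Big\{d_k\prod_{j=1}^{k-1}d_j(d_j-1): d_1,\dots,d_k\in\mathbb{N}\setminus\{1\}\Big\}\subset\mathbb{N}, \] and define \[ \underline{\lambda}_\psi=\liminf_{k\to\infty}\ \liminf_{q\in S_k,\,q\to\infty}\frac{-\log\psi(q)}{\log q},\qquad \overline{\lambda}_\psi=\liminf_{k\to\infty}\ \limsup_{q\in S_k,\,q\to\infty}\frac{-\log\psi(q)}{\log q}. \] Then $\underline{\lambda}_\psi\geq\underline{\tau}_\psi$, $\overline{\lambda}_\psi\le\overline{\tau}_\psi$, and \[ \frac{1}{1+\overline{\lambda}_\psi}\leq \dim_H L(\psi)\leq\frac{1}{1+\underline{\lambda}_\psi}, \] where $\underline{\tau}_\psi=\liminf_{q\to\infty}\frac{-\log\psi(q)}{\log q}$ and $\overline{\tau}_\psi=\limsup_{q\to\infty}\frac{-\log\psi(q)}{\log q}$.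
   Context: Every $x\in(0,1]$ has a unique Lüroth expansion $x=\sum_{k=1}^\infty \frac{1}{d_k\prod_{j=1}^{k-1}d_j(d_j-1)}$ with digits $d_k=d_k(x)\in\{2,3,4,\dots\}$. For $n\in\mathbb{N}$ define $Q_n(x)=d_n\prod_{j=1}^{n-1}d_j(d_j-1)$ (empty product $=1$) and $P_n(x)=Q_n(x)\sum_{k=1}^n \frac{1}{d_k\prod_{j=1}^{k-1}d_j(d_j-1)}$. For $\psi:\mathbb{N}\to(0,1]$, \[ L(\psi)=\limsup_{n\to\infty}\Big\{x\in(0,1]: \Big|x-\frac{P_n(x)}{Q_n(x)}\Big|<\frac{\psi(Q_n(x))}{Q_n(x)}\Big\}, \] the set of $x$ for which the inequality holds for infinitely many $n$. $\dim_H$ is Hausdorff dimension; $1/(1+\infty)=0$. *)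

theory Defs
  imports "HOL-Analysis.Analysis"
begin

section \<open>Hausdorff dimension\<close>

text \<open>
  The contribution of a covering set \<open>U\<close> at exponent \<open>s\<close> is \<open>(diam U)\<^sup>s\<close>, where the empty set
  contributes 0 and \<open>0\<^sup>0 = 1\<close> for nonempty sets (\<open>powr\<close> would give \<open>0 powr 0 = 0\<close>).
\<close>

definition hausdorff_weight :: "real \<Rightarrow> 'a::metric_space set \<Rightarrow> ennreal" where
  "hausdorff_weight s U =
     (if U = {} then 0 else if s = 0 then 1 else ennreal (diameter U powr s))"

text \<open>
  Boundedness of the covering sets is explicit because \<open>diameter\<close> is unspecified on unbounded sets.
  Finite covers are included, by padding with empty sets.
\<close>

definition hausdorff_premeasure :: "real \<Rightarrow> real \<Rightarrow> 'a::metric_space set \<Rightarrow> ennreal" where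
  "hausdorff_premeasure s \<delta> A =
     (INF U \<in> {U :: nat \<Rightarrow> 'a set.
          A \<subseteq> (\<Union>i. U i) \<and> (\<forall>i. bounded (U i) \<and> diameter (U i) \<le> \<delta>)}.
        (\<Sum>i. hausdorff_weight s (U i)))"

definition hausdorff_measure :: "real \<Rightarrow> 'a::metric_space set \<Rightarrow> ennreal" where
  "hausdorff_measure s A = (SUP \<delta> \<in> {0<..}. hausdorff_premeasure s \<delta> A)"

definition hausdorff_dim :: "'a::metric_space set \<Rightarrow> ereal" where
  "hausdorff_dim A = (INF s \<in> {s. 0 \<le> s \<and> hausdorff_measure s A = 0}. ereal s)"


section \<open>Lueroth expansions\<close>

text \<open>
  Digit sequences are indexed from 1; the value at index 0 is never used.
\<close>

definition luroth_denom :: "(nat \<Rightarrow> nat) \<Rightarrow> nat \<Rightarrow> nat" where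
  "luroth_denom d k = d k * (\<Prod>j = 1..<k. d j * (d j - 1))"

definition is_luroth_expansion :: "(nat \<Rightarrow> nat) \<Rightarrow> real \<Rightarrow> bool" where
  "is_luroth_expansion d x \<longleftrightarrow>
     (\<forall>k\<ge>1. d k \<ge> 2) \<and> (\<lambda>k. 1 / real (luroth_denom d (Suc k))) sums x"

lemma luroth_denom_1 [simp]: "luroth_denom d (Suc 0) = d 1"
  by (simp add: luroth_denom_def)

lemma luroth_denom_shift:
  "luroth_denom d (Suc (Suc k)) = d 1 * (d 1 - 1) * luroth_denom (\<lambda>j. d (Suc j)) (Suc k)"
proof -
  have "(\<Prod>j = 1..<Suc (Suc k). d j * (d j - 1)) =
        d 1 * (d 1 - 1) * (\<Prod>j = Suc 1..<Suc (Suc k). d j * (d j - 1))"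
    by (subst prod.atLeast_Suc_lessThan) auto
  also have "(\<Prod>j = Suc 1..<Suc (Suc k). d j * (d j - 1)) =
             (\<Prod>j = 1..<Suc k. d (Suc j) * (d (Suc j) - 1))"
    by (subst prod.shift_bounds_Suc_ivl) simp
  finally show ?thesis
    by (simp add: luroth_denom_def)
qed

lemma luroth_denom_pos:
  assumes "\<And>k. k \<ge> 1 \<Longrightarrow> d k \<ge> 2"
  shows "luroth_denom d (Suc k) > 0"
proof -
  have "d j * (d j - 1) > 0" if "j \<ge> 1" for j
    using assms [OF that] by simp
  then have "(\<Prod>j = 1..<Suc k. d j * (d j - 1)) > 0"
    by (intro prod_pos) auto
  moreover have "d (Suc k) > 0" using assms [of "Suc k"] by simp
  ultimately show ?thesis by (simp add: luroth_denom_def)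
qed

lemma luroth_recip_step:
  assumes "m \<ge> (2::nat)"
  shows "1 / real m + 1 / real (m * (m - 1)) = 1 / (real m - 1)"
proof -
  have "real (m - 1) = real m - 1" "real m > 1"
    using assms by auto
  then show ?thesis by (simp add: field_simps)
qed

lemma luroth_partial_sum_Suc:
  "(\<Sum>k<Suc n. 1 / real (luroth_denom d (Suc k))) =
   1 / real (d 1) + 1 / real (d 1 * (d 1 - 1)) *
     (\<Sum>k<n. 1 / real (luroth_denom (\<lambda>j. d (Suc j)) (Suc k)))"
  by (subst sum.lessThan_Suc_shift) (simp add: luroth_denom_shift sum_distrib_left)

lemma luroth_partial_sum_le_1:
  assumes "\<And>k. k \<ge> 1 \<Longrightarrow> d k \<ge> 2"
  shows "(\<Sum>k<n. 1 / real (luroth_denom d (Suc k))) \<le> 1"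
  using assms
proof (induction n arbitrary: d)
  case (Suc n)
  have d: "d 1 \<ge> 2" using Suc.prems by simp
  have "(\<Sum>k<n. 1 / real (luroth_denom (\<lambda>j. d (Suc j)) (Suc k))) \<le> 1"
    using Suc.prems by (intro Suc.IH) auto
  then have "1 / real (d 1 * (d 1 - 1)) *
      (\<Sum>k<n. 1 / real (luroth_denom (\<lambda>j. d (Suc j)) (Suc k))) \<le> 1 / real (d 1 * (d 1 - 1)) * 1"
    by (intro mult_left_mono) auto
  then have "(\<Sum>k<Suc n. 1 / real (luroth_denom d (Suc k))) \<le> 1 / (real (d 1) - 1)"
    unfolding luroth_partial_sum_Suc luroth_recip_step [OF d, symmetric] by simp
  also have "\<dots> \<le> 1" using d by simp
  finally show ?case .
qed simp

lemma luroth_expansion_range: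
  assumes "is_luroth_expansion d x"
  shows "0 < x" "x \<le> 1"
proof -
  have d: "\<And>k. k \<ge> 1 \<Longrightarrow> d k \<ge> 2" and s: "(\<lambda>k. 1 / real (luroth_denom d (Suc k))) sums x"
    using assms by (auto simp: is_luroth_expansion_def)
  have "0 < (\<Sum>k. 1 / real (luroth_denom d (Suc k)))"
    using luroth_denom_pos [of d] d sums_summable [OF s] by (intro suminf_pos) auto
  then show "0 < x" using sums_unique [OF s] by simp
  show "x \<le> 1"
    using s d unfolding sums_def
    by (intro LIMSEQ_le_const2 [of _ x]) (blast intro: luroth_partial_sum_le_1)+
qed

lemma luroth_expansion_shift:
  assumes "is_luroth_expansion d x"
  shows "is_luroth_expansion (\<lambda>j. d (Suc j)) (real (d 1 * (d 1 - 1)) * (x - 1 / real (d 1)))"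
proof -
  have d: "\<And>k. k \<ge> 1 \<Longrightarrow> d k \<ge> 2" and s: "(\<lambda>k. 1 / real (luroth_denom d (Suc k))) sums x"
    using assms by (auto simp: is_luroth_expansion_def)
  define c where "c = real (d 1 * (d 1 - 1))"
  have "d 1 \<ge> 2" using d by simp
  then have c: "c > 0" by (simp add: c_def)
  have "(\<lambda>k. 1 / real (luroth_denom d (Suc (Suc k)))) sums (x - 1 / real (d 1))"
    using s by (subst sums_Suc_iff) simp
  then have "(\<lambda>k. c * (1 / real (luroth_denom d (Suc (Suc k))))) sums (c * (x - 1 / real (d 1)))"
    by (rule sums_mult)
  moreover have "c * (1 / real (luroth_denom d (Suc (Suc k)))) =
      1 / real (luroth_denom (\<lambda>j. d (Suc j)) (Suc k))" for k
    using c unfolding luroth_denom_shift of_nat_mult [of "d 1 * (d 1 - 1)"] c_def [symmetric]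
    by simp
  ultimately show ?thesis
    using d by (simp add: is_luroth_expansion_def c_def)
qed

lemma luroth_first_digit:
  assumes "is_luroth_expansion d x"
  shows "int (d 1) = \<lfloor>1 / x\<rfloor> + 1"
proof -
  have d: "d 1 \<ge> 2" using assms by (auto simp: is_luroth_expansion_def)
  define c where "c = real (d 1 * (d 1 - 1))"
  have c: "c > 0" using d by (simp add: c_def)
  have x: "x > 0" using luroth_expansion_range [OF assms] by simp
  have r: "0 < c * (x - 1 / real (d 1))" "c * (x - 1 / real (d 1)) \<le> 1"
    using luroth_expansion_range [OF luroth_expansion_shift [OF assms]] unfolding c_def by blast+
  from r(1) c have lo: "1 / real (d 1) < x" by (simp add: zero_less_mult_iff)
  from r(2) c have "x \<le> 1 / real (d 1) + 1 / c" by (simp add: field_simps)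
  then have hi: "x \<le> 1 / (real (d 1) - 1)"
    using luroth_recip_step [OF d] by (simp add: c_def)
  have "1 / x < real (d 1)" using lo x d by (simp add: field_simps)
  moreover have "real (d 1) - 1 \<le> 1 / x" using hi x d by (simp add: field_simps)
  ultimately show ?thesis by linarith
qed

lemma luroth_expansion_unique:
  assumes "is_luroth_expansion d x" "is_luroth_expansion e x" "k \<ge> 1"
  shows "d k = e k"
proof -
  have "d (Suc n) = e (Suc n)" if "is_luroth_expansion d x" "is_luroth_expansion e x" for n d e x
    using that
  proof (induction n arbitrary: d e x)
    case 0
    then have "int (d 1) = int (e 1)" by (simp only: luroth_first_digit)
    then show ?case by simp
  next
    case (Suc n)
    from Suc.prems have "int (d 1) = int (e 1)" by (simp only: luroth_first_digit)
    then have "d 1 = e 1" by simp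
    with luroth_expansion_shift [OF Suc.prems(1)] luroth_expansion_shift [OF Suc.prems(2)]
    show ?case using Suc.IH by metis
  qed
  from this [OF assms(1,2), of "k - 1"] assms(3) show ?thesis by simp
qed

lemma luroth_expansion_exists:
  fixes x :: real
  assumes "x \<in> {0<..1}"
  obtains d where "is_luroth_expansion d x"
proof -
  define D where "D y = nat \<lfloor>1 / y\<rfloor> + 1" for y :: real
  define T where "T y = real (D y * (D y - 1)) * (y - 1 / real (D y))" for y :: real
  have D: "D y \<ge> 2 \<and> 0 < T y \<and> T y \<le> 1" if "0 < y" "y \<le> 1" for y
  proof -
    have fl: "\<lfloor>1 / y\<rfloor> \<ge> 1" using that by (simp add: le_floor_iff)
    then have 2: "D y \<ge> 2" unfolding D_def by linarith
    have rD: "real (D y) = real_of_int \<lfloor>1 / y\<rfloor> + 1" using fl unfolding D_def by linarith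
    have a: "1 / y < real (D y)" "real (D y) - 1 \<le> 1 / y" unfolding rD by linarith+
    have r: "real (D y - 1) = real (D y) - 1" using 2 by simp
    have "T y = (real (D y) - 1) * (real (D y) * y - 1)"
      using 2 unfolding T_def of_nat_mult r by (simp add: field_simps)
    moreover have "real (D y) * y > 1" using a(1) that by (simp add: field_simps)
    moreover have "(real (D y) - 1) * y \<le> 1" using a(2) that by (simp add: field_simps)
    moreover have "(real (D y) - 1) * (real (D y) * y - 1) =
        real (D y) * ((real (D y) - 1) * y) - real (D y) + 1"
      by (simp add: algebra_simps)
    moreover have "real (D y) * ((real (D y) - 1) * y) \<le> real (D y) * 1"
      using \<open>(real (D y) - 1) * y \<le> 1\<close> by (intro mult_left_mono) auto
    moreover have "0 < (real (D y) - 1) * (real (D y) * y - 1)"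
      using 2 \<open>real (D y) * y > 1\<close> by (intro mult_pos_pos) auto
    ultimately show ?thesis using 2 by simp
  qed
  define d where "d k = D ((T ^^ (k - 1)) x)" for k
  have orbit: "0 < (T ^^ n) x \<and> (T ^^ n) x \<le> 1" for n
    using assms by (induction n) (auto simp: D)
  have d2: "d k \<ge> 2" for k
    unfolding d_def using D orbit by blast
  define R where "R n = (\<Prod>j = 1..<Suc n. real (d j * (d j - 1)))" for n
  have R_Suc: "R (Suc n) = R n * real (d (Suc n) * (d (Suc n) - 1))" for n
    by (simp add: R_def)
  have R_ge: "R n \<ge> 2 ^ n" for n
  proof (induction n)
    case (Suc n)
    have "2 * 1 \<le> d (Suc n) * (d (Suc n) - 1)" using d2 [of "Suc n"] by (intro mult_mono) auto
    then have "real (d (Suc n) * (d (Suc n) - 1)) \<ge> 2" by linarith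
    moreover have "0 \<le> R n" using Suc.IH by (rule order_trans [rotated]) simp
    ultimately have "2 ^ n * 2 \<le> R (Suc n)"
      unfolding R_Suc by (rule mult_mono [OF Suc.IH]) linarith
    then show ?case by simp
  qed (simp add: R_def)
  have R_pos: "R n > 0" for n
    using R_ge [of n] by (meson less_le_trans zero_less_numeral zero_less_power)
  have ps: "(\<Sum>k<n. 1 / real (luroth_denom d (Suc k))) = x - (T ^^ n) x / R n" for n
  proof (induction n)
    case (Suc n)
    define y m where "y = (T ^^ n) x" and "m = d (Suc n)"
    have m: "m \<ge> 2" "m = D y" using d2 [of "Suc n"] by (auto simp: m_def y_def d_def)
    have den: "real (luroth_denom d (Suc n)) = real m * R n"
      by (simp add: luroth_denom_def R_def m_def)
    have mm: "real (m * (m - 1)) > 0" using m(1) by simp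
    have "(T ^^ Suc n) x / R (Suc n) = real (m * (m - 1)) * (y - 1 / m) / (R n * real (m * (m - 1)))"
      by (simp only: R_Suc funpow.simps o_apply T_def m(2) m_def [symmetric] y_def [symmetric])
    also have "\<dots> = (y - 1 / m) / R n"
      using mm by (metis mult.commute mult_divide_mult_cancel_right less_irrefl)
    finally show ?case
      using Suc.IH by (simp add: den y_def diff_divide_distrib)
  qed (simp add: R_def)
  have "(\<lambda>n. (T ^^ n) x / R n) \<longlonglongrightarrow> 0"
  proof (rule Lim_null_comparison)
    have "norm ((T ^^ n) x / R n) \<le> 1 / 2 ^ n" for n
      using orbit [of n] R_pos [of n] R_ge [of n] by (simp add: frac_le)
    then show "\<forall>\<^sub>F n in sequentially. norm ((T ^^ n) x / R n) \<le> 1 / 2 ^ n" by simp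
    show "(\<lambda>n. 1 / 2 ^ n :: real) \<longlonglongrightarrow> 0"
      using LIMSEQ_inverse_realpow_zero [of 2] by (simp add: inverse_eq_divide)
  qed
  then have "(\<lambda>n. x - (T ^^ n) x / R n) \<longlonglongrightarrow> x - 0" by (intro tendsto_intros)
  then have "(\<lambda>k. 1 / real (luroth_denom d (Suc k))) sums x" by (simp add: sums_def ps)
  with d2 that show thesis by (auto simp: is_luroth_expansion_def)
qed

text \<open>
  For \<open>x \<in> (0,1]\<close> and \<open>k \<ge> 1\<close> this description is proper, by \<open>luroth_expansion_exists\<close> and
  \<open>luroth_expansion_unique\<close>.
\<close>

definition luroth_digit :: "real \<Rightarrow> nat \<Rightarrow> nat" where
  "luroth_digit x k = (THE m. \<exists>d. is_luroth_expansion d x \<and> d k = m)"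

lemma luroth_digit_eq:
  assumes "is_luroth_expansion d x" "k \<ge> 1"
  shows "luroth_digit x k = d k"
  unfolding luroth_digit_def using assms luroth_expansion_unique by blast

definition luroth_Q :: "real \<Rightarrow> nat \<Rightarrow> nat" where
  "luroth_Q x n = luroth_denom (luroth_digit x) n"

definition luroth_P :: "real \<Rightarrow> nat \<Rightarrow> real" where
  "luroth_P x n =
     real (luroth_Q x n) * (\<Sum>k = 1..n. 1 / real (luroth_denom (luroth_digit x) k))"

definition luroth_approx_set :: "(nat \<Rightarrow> real) \<Rightarrow> real set" where
  "luroth_approx_set \<psi> =
     {x \<in> {0<..1}. infinite {n. n \<ge> 1 \<and>
        \<bar>x - luroth_P x n / real (luroth_Q x n)\<bar> < \<psi> (luroth_Q x n) / real (luroth_Q x n)}}"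


section \<open>Exponents of an approximation function\<close>

definition luroth_denoms :: "nat \<Rightarrow> nat set" where
  "luroth_denoms k = {luroth_denom d k | d. \<forall>j\<in>{1..k}. d j \<ge> 2}"

definition decay_rate :: "(nat \<Rightarrow> real) \<Rightarrow> nat \<Rightarrow> ereal" where
  "decay_rate \<psi> q = ereal (- ln (\<psi> q) / ln (real q))"

text \<open>
  The filter \<open>sequentially \<sqinter> principal (luroth_denoms k)\<close> expresses \<open>q \<rightarrow> \<infinity>\<close> along \<open>luroth_denoms k\<close>.
  The degenerate indices \<open>k = 0\<close> and \<open>q \<le> 1\<close> do not influence any of the limits.
\<close>

definition lower_lambda :: "(nat \<Rightarrow> real) \<Rightarrow> ereal" where
  "lower_lambda \<psi> =
     liminf (\<lambda>k. Liminf (inf sequentially (principal (luroth_denoms k))) (decay_rate \<psi>))"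

definition upper_lambda :: "(nat \<Rightarrow> real) \<Rightarrow> ereal" where
  "upper_lambda \<psi> =
     liminf (\<lambda>k. Limsup (inf sequentially (principal (luroth_denoms k))) (decay_rate \<psi>))"

definition lower_tau :: "(nat \<Rightarrow> real) \<Rightarrow> ereal" where
  "lower_tau \<psi> = liminf (decay_rate \<psi>)"

definition upper_tau :: "(nat \<Rightarrow> real) \<Rightarrow> ereal" where
  "upper_tau \<psi> = limsup (decay_rate \<psi>)"

end

theory Submission
  imports Defs
begin

text \<open>
  Since \<open>d (d - 1)\<close> is even, \<open>S\<^sub>k = 2^(k-1) \<cdot> {2, 3, \<dots>}\<close>, so these sets decrease in \<open>k\<close> and
  \<open>Q\<^sub>n(x) \<in> S\<^sub>k\<close> for all \<open>n \<ge> k\<close>. Hence a bound \<open>\<psi>(q) \<le> q powr (- t)\<close> or \<open>\<psi>(q) > q powr (- t)\<close>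
  that holds for large \<open>q\<close> in a single \<open>S\<^sub>k\<close> holds along all \<open>Q\<^sub>n(x)\<close> with \<open>n\<close> large, uniformly in \<open>x\<close>,
  and it is enough to treat \<open>\<psi>(q) = q powr (- t)\<close>.

  Upper bound: cover by the intervals \<open>[P/Q, P/Q + Q powr (- (1 + t))]\<close>. The sum of their
  \<open>s\<close>-th powers over all words of length \<open>n\<close> decays geometrically as soon as \<open>s (1 + t) > 1\<close>,
  because the cylinders of order \<open>n\<close> have total length 1.

  Lower bound: let \<open>s (1 + t) < 1\<close> and let a cover by balls of radii \<open>r\<^sub>i\<close> with tiny \<open>\<Sum> r\<^sub>i powr s\<close>
  be given. Instead of building a measure, one descends through nested approximation intervals \<open>I\<close>
  keeping \<open>\<Sum> r\<^sub>i powr s \<le> (|I| / 100) powr s\<close>, the sum being over the balls that meet \<open>I\<close>. An average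
  over the deep cylinders inside \<open>I\<close>, weighted by their lengths, shows that some child has the same
  property. The limit point lies in \<open>L(\<psi>)\<close> but in no ball of the cover.
\<close>

section \<open>Words of digits and cylinders\<close>

text \<open>The reciprocal length of a cylinder, not Q_n: for the word \<open>u @ [m]\<close> the
  denominator Q_n is \<open>word_den u * m\<close>, without the factor \<open>m - 1\<close>. The
  recursion strips the first digit, as the Lueroth map does.\<close>

fun word_den :: "nat list \<Rightarrow> nat" where
  "word_den [] = 1"
| "word_den (m # w) = m * (m - 1) * word_den w"

fun word_val :: "nat list \<Rightarrow> real" where
  "word_val [] = 0"
| "word_val (m # w) = 1 / real m + word_val w / real (m * (m - 1))"

text \<open>A point with initial word \<open>w\<close> is
  \<open>word_val w + y / word_den w\<close>, where \<open>y\<close> is the value of the remaining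
  expansion. Values range over (0,1]: 0 would need a terminating expansion, and 1 is the value of 2,
  2, 2, ....\<close>

definition cylinder :: "nat list \<Rightarrow> real set" where
  "cylinder w = {word_val w <.. word_val w + 1 / real (word_den w)}"

definition luroth_words :: "nat \<Rightarrow> nat list set" where
  "luroth_words n = {w. length w = n \<and> set w \<subseteq> {2..}}"

lemma word_den_snoc [simp]: "word_den (u @ [m]) = word_den u * (m * (m - 1))"
  by (induction u) auto

lemma word_val_snoc: "word_val (u @ [m]) = word_val u + 1 / real (word_den u * m)"
  by (induction u) (auto simp: add_divide_distrib)

lemma word_den_ge:
  assumes "set w \<subseteq> {2..}"
  shows "2 ^ length w \<le> word_den w"
  using assms
proof (induction w)
  case (Cons m w)
  then have "m \<ge> 2" "2 ^ length w \<le> word_den w" by auto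
  moreover from \<open>m \<ge> 2\<close> have "2 * 1 \<le> m * (m - 1)" by (intro mult_mono) auto
  ultimately have "(2 * 1) * 2 ^ length w \<le> (m * (m - 1)) * word_den w"
    by (intro mult_mono) auto
  then show ?case by simp
qed simp

lemma word_den_pos: "set w \<subseteq> {2..} \<Longrightarrow> 0 < word_den w"
  using word_den_ge [of w] by (meson less_le_trans pos2 zero_less_power)

lemma power_dvd_word_den: "2 ^ length w dvd word_den w"
proof (induction w)
  case (Cons m w)
  have "2 dvd m * (m - 1)" by (cases m) auto
  then have "2 * 2 ^ length w dvd (m * (m - 1)) * word_den w"
    using Cons.IH by (rule mult_dvd_mono)
  then show ?case by simp
qed simp

text \<open>The affine map \<open>x\<close> to \<open>m * (m - 1) * (x - 1 / m)\<close> is the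
  branch of the Lueroth map on first digit \<open>m\<close>; it carries
  \<open>cylinder (m # w)\<close> onto \<open>cylinder w\<close>. This is the induction step for
  everything about cylinders.\<close>

lemma mem_cylinder_Cons:
  assumes "m \<ge> 2"
  shows "x \<in> cylinder (m # w) \<longleftrightarrow> real (m * (m - 1)) * (x - 1 / real m) \<in> cylinder w"
proof -
  define c where "c = real (m * (m - 1))"
  have c: "c > 0" using assms by (simp add: c_def)
  have "word_val (m # w) < x \<longleftrightarrow> word_val w < c * (x - 1 / real m)"
    using c unfolding word_val.simps c_def [symmetric]
    by (metis less_diff_eq add.commute mult.commute pos_divide_less_eq)
  moreover have "x \<le> word_val (m # w) + 1 / real (word_den (m # w)) \<longleftrightarrow>
      c * (x - 1 / real m) \<le> word_val w + 1 / real (word_den w)"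
  proof -
    have "word_val (m # w) + 1 / real (word_den (m # w)) =
        1 / real m + (word_val w + 1 / real (word_den w)) / c"
      unfolding word_val.simps word_den.simps of_nat_mult [of "m * (m - 1)"] c_def [symmetric]
      by (simp add: add_divide_distrib mult.commute)
    also have "x \<le> \<dots> \<longleftrightarrow> x - 1 / real m \<le> (word_val w + 1 / real (word_den w)) / c"
      by linarith
    also have "\<dots> \<longleftrightarrow> c * (x - 1 / real m) \<le> word_val w + 1 / real (word_den w)"
      using c by (simp add: pos_le_divide_eq mult.commute)
    finally show ?thesis .
  qed
  ultimately show ?thesis unfolding cylinder_def c_def by simp
qed

text \<open>The hypothesis places \<open>x\<close> in (1/m, 1/(m-1)], because 1/m + 1/(m(m-1)) =
  1/(m-1), and there \<open>m - 1 \<le> 1 / x < m\<close>.\<close>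

lemma cylinder_first_digit:
  assumes "m \<ge> 2" "real (m * (m - 1)) * (x - 1 / real m) \<in> {0<..1}"
  shows "x \<in> {0<..1}" "int m = \<lfloor>1 / x\<rfloor> + 1"
proof -
  define c where "c = real (m * (m - 1))"
  have c: "c > 0" using assms by (simp add: c_def)
  have r: "0 < c * (x - 1 / real m)" "c * (x - 1 / real m) \<le> 1"
    using assms(2) unfolding c_def by auto
  from r(1) c have lo: "1 / real m < x" by (simp add: zero_less_mult_iff)
  have "0 < 1 / real m" using assms by simp
  with lo have x: "0 < x" by linarith
  from r(2) c have "x - 1 / real m \<le> 1 / c" by (simp add: pos_le_divide_eq mult.commute)
  then have hi: "x \<le> 1 / (real m - 1)"
    using luroth_recip_step [OF assms(1)] by (simp add: c_def)
  also have "\<dots> \<le> 1" using assms by simp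
  finally show "x \<in> {0<..1}" using x by simp
  have "1 / x < real m" using lo x assms by (simp add: field_simps)
  moreover have "real m - 1 \<le> 1 / x" using hi x assms by (simp add: field_simps)
  ultimately show "int m = \<lfloor>1 / x\<rfloor> + 1" by linarith
qed

lemma cylinder_subset:
  assumes "set w \<subseteq> {2..}"
  shows "cylinder w \<subseteq> {0<..1}"
  using assms
proof (induction w)
  case (Cons m w)
  then have m: "m \<ge> 2" and w: "cylinder w \<subseteq> {0<..1}" by auto
  show ?case
    using cylinder_first_digit(1) [OF m] mem_cylinder_Cons [OF m] w by blast
qed (auto simp: cylinder_def)

section \<open>Words read off from an expansion\<close>

definition digit_word :: "(nat \<Rightarrow> nat) \<Rightarrow> nat \<Rightarrow> nat list" where
  "digit_word d n = map d [1..<Suc n]"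

lemma digit_word_0 [simp]: "digit_word d 0 = []"
  by (simp add: digit_word_def)

lemma length_digit_word [simp]: "length (digit_word d n) = n"
  by (simp add: digit_word_def)

lemma digit_word_Suc: "digit_word d (Suc n) = digit_word d n @ [d (Suc n)]"
  by (simp add: digit_word_def)

lemma digit_word_Cons: "digit_word d (Suc n) = d 1 # digit_word (\<lambda>j. d (Suc j)) n"
proof -
  have "[1..<Suc (Suc n)] = 1 # map Suc [1..<Suc n]"
    by (subst map_Suc_upt) (simp add: upt_rec)
  then show ?thesis by (simp add: digit_word_def)
qed

lemma expansion_digit_word:
  assumes "is_luroth_expansion d x"
  shows "set (digit_word d n) \<subseteq> {2..}"
  using assms by (auto simp: digit_word_def is_luroth_expansion_def)

lemma expansion_mem_cylinder:
  assumes "is_luroth_expansion d x"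
  shows "x \<in> cylinder (digit_word d n)"
  using assms
proof (induction n arbitrary: d x)
  case 0
  then show ?case using luroth_expansion_range by (simp add: cylinder_def)
next
  case (Suc n)
  have "d 1 \<ge> 2" using Suc.prems by (simp add: is_luroth_expansion_def)
  then show ?case
    unfolding digit_word_Cons using mem_cylinder_Cons Suc.IH luroth_expansion_shift Suc.prems
    by blast
qed

text \<open>The first digit is a function of \<open>x\<close> alone, and stripping it from the word
  and from the expansion applies the same branch to \<open>x\<close>. Disjointness of cylinders of
  equal order follows.\<close>

lemma mem_cylinder_word_eq:
  assumes "set w \<subseteq> {2..}" "x \<in> cylinder w" "is_luroth_expansion d x"
  shows "w = digit_word d (length w)"
  using assms
proof (induction w arbitrary: d x)
  case (Cons m w)
  then have m: "m \<ge> 2" and w: "set w \<subseteq> {2..}" by auto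
  have y: "real (m * (m - 1)) * (x - 1 / real m) \<in> cylinder w"
    using Cons.prems(2) mem_cylinder_Cons [OF m] by blast
  have "int m = int (d 1)"
    using cylinder_first_digit(2) [OF m] y cylinder_subset [OF w]
      luroth_first_digit [OF Cons.prems(3)] by (metis subsetD)
  then have md: "m = d 1" by simp
  have "w = digit_word (\<lambda>j. d (Suc j)) (length w)"
    using Cons.IH [OF w y] luroth_expansion_shift [OF Cons.prems(3)] unfolding md by blast
  then show ?case using md by (simp add: digit_word_Cons)
qed simp

lemma luroth_denom_digit_word: "luroth_denom d (Suc n) = word_den (digit_word d n) * d (Suc n)"
proof -
  have "(\<Prod>j = 1..<Suc n. d j * (d j - 1)) = word_den (digit_word d n)"
    by (induction n) (auto simp: digit_word_Suc)
  then show ?thesis by (simp add: luroth_denom_def)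
qed

lemma word_val_digit_word:
  "word_val (digit_word d n) = (\<Sum>k = 1..n. 1 / real (luroth_denom d k))"
  by (induction n) (auto simp: digit_word_Suc word_val_snoc luroth_denom_digit_word)

text \<open>This trades digit functions for words: being in the cylinder of \<open>u @ [m]\<close>
  forces \<open>u @ [m]\<close> to be the initial digits of \<open>x\<close>, so P_n/Q_n is
  \<open>word_val (u @ [m])\<close> and Q_n is \<open>word_den u * m\<close>. The last digit is kept
  apart because it enters Q_n differently.\<close>

lemma mem_luroth_approx_set_iff:
  "x \<in> luroth_approx_set \<psi> \<longleftrightarrow>
     (\<forall>N. \<exists>u m. N \<le> length u \<and> set (u @ [m]) \<subseteq> {2..} \<and> x \<in> cylinder (u @ [m]) \<and>
        \<bar>x - word_val (u @ [m])\<bar> < \<psi> (word_den u * m) / real (word_den u * m))"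
    (is "_ \<longleftrightarrow> (\<forall>N. \<exists>u m. ?R N u m)")
proof (cases "x \<in> {0<..1}")
  case False
  then have "\<not> ?R N u m" for N u m
    using cylinder_subset [of "u @ [m]"] by blast
  moreover have "x \<notin> luroth_approx_set \<psi>" using False unfolding luroth_approx_set_def by blast
  ultimately show ?thesis by blast
next
  case True
  then obtain d where d: "is_luroth_expansion d x" by (rule luroth_expansion_exists)
  have Q: "luroth_Q x n = luroth_denom d n" if "n \<ge> 1" for n
    using that luroth_digit_eq [OF d] by (simp add: luroth_Q_def luroth_denom_def)
  have dpos: "luroth_denom d n > 0" if "n \<ge> 1" for n
    using luroth_denom_pos [of d "n - 1"] d that by (simp add: is_luroth_expansion_def)
  have PQ: "luroth_P x n / real (luroth_Q x n) = word_val (digit_word d n)" if "n \<ge> 1" for n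
  proof -
    have "(\<Sum>k = 1..n. 1 / real (luroth_denom (luroth_digit x) k)) =
        (\<Sum>k = 1..n. 1 / real (luroth_denom d k))"
      using luroth_digit_eq [OF d] by (intro sum.cong) (auto simp: luroth_denom_def)
    then show ?thesis
      using dpos [OF that] Q [OF that] by (simp add: luroth_P_def word_val_digit_word)
  qed
  define G where "G n \<longleftrightarrow> \<bar>x - word_val (digit_word d n)\<bar> <
      \<psi> (luroth_denom d n) / real (luroth_denom d n)" for n
  have "{n. n \<ge> 1 \<and> \<bar>x - luroth_P x n / real (luroth_Q x n)\<bar> <
      \<psi> (luroth_Q x n) / real (luroth_Q x n)} = {n. n \<ge> 1 \<and> G n}"
    using PQ Q by (auto simp: G_def)
  then have "x \<in> luroth_approx_set \<psi> \<longleftrightarrow> infinite {n. n \<ge> 1 \<and> G n}"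
    using True by (simp add: luroth_approx_set_def)
  \<comment> \<open>The index is shifted by one so that \<open>n\<close> becomes the length of
    \<open>u\<close>.\<close>
  also have "\<dots> \<longleftrightarrow> (\<forall>N. \<exists>n\<ge>N. G (Suc n))"
    unfolding infinite_nat_iff_unbounded
    by (metis (mono_tags, lifting) Suc_le_D le_eq_less_or_eq less_Suc_eq_le mem_Collect_eq
        not_less_eq_eq zero_less_Suc One_nat_def)
  also have "\<dots> \<longleftrightarrow> (\<forall>N. \<exists>u m. ?R N u m)"
  proof (intro iff_allI iffI)
    fix N assume "\<exists>n\<ge>N. G (Suc n)"
    then obtain n where n: "n \<ge> N" "G (Suc n)" by blast
    then have "?R N (digit_word d n) (d (Suc n))"
      using expansion_digit_word [OF d, of "Suc n"] expansion_mem_cylinder [OF d, of "Suc n"]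
      unfolding digit_word_Suc G_def luroth_denom_digit_word by auto
    then show "\<exists>u m. ?R N u m" by blast
  next
    fix N assume "\<exists>u m. ?R N u m"
    then obtain u m where um: "?R N u m" by blast
    define n where "n = length u"
    have "u @ [m] = digit_word d (Suc n)"
      using mem_cylinder_word_eq [of "u @ [m]" x d] um d by (simp add: n_def)
    then have "u = digit_word d n" "m = d (Suc n)" by (auto simp: digit_word_Suc)
    with um have "G (Suc n)" "n \<ge> N"
      by (auto simp: G_def luroth_denom_digit_word digit_word_Suc)
    then show "\<exists>n\<ge>N. G (Suc n)" by blast
  qed
  finally show ?thesis .
qed

section \<open>The partition of the unit interval into cylinders of order n\<close>

lemma mem_luroth_wordsD:
  assumes "w \<in> luroth_words n"
  shows "length w = n" "set w \<subseteq> {2..}" "2 ^ n \<le> word_den w" "0 < word_den w"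
  using assms word_den_ge [of w] word_den_pos [of w] by (auto simp: luroth_words_def)

lemma UN_cylinder: "(\<Union>w\<in>luroth_words n. cylinder w) = {0<..1}"
proof
  show "(\<Union>w\<in>luroth_words n. cylinder w) \<subseteq> {0<..1}"
    using cylinder_subset by (force simp: luroth_words_def)
  show "{0<..1} \<subseteq> (\<Union>w\<in>luroth_words n. cylinder w)"
  proof
    fix x :: real assume "x \<in> {0<..1}"
    then obtain d where "is_luroth_expansion d x" by (rule luroth_expansion_exists)
    then show "x \<in> (\<Union>w\<in>luroth_words n. cylinder w)"
      using expansion_mem_cylinder [of d x n] expansion_digit_word [of d x n]
      by (auto simp: luroth_words_def intro!: exI [of _ "digit_word d n"])
  qed
qed

lemma disjoint_family_cylinder: "disjoint_family_on cylinder (luroth_words n)"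
unfolding disjoint_family_on_def
proof (intro ballI impI)
  fix v w assume vw: "v \<in> luroth_words n" "w \<in> luroth_words n" "v \<noteq> w"
  show "cylinder v \<inter> cylinder w = {}"
  proof (rule ccontr)
    assume "cylinder v \<inter> cylinder w \<noteq> {}"
    then obtain x where x: "x \<in> cylinder v" "x \<in> cylinder w" by blast
    have "x \<in> {0<..1}" using x(1) cylinder_subset [OF mem_luroth_wordsD(2) [OF vw(1)]] by blast
    then obtain d where "is_luroth_expansion d x" by (rule luroth_expansion_exists)
    then show False
      using mem_cylinder_word_eq x vw by (metis mem_luroth_wordsD(1,2))
  qed
qed

lemma cylinder_sets [measurable, simp]: "cylinder w \<in> sets borel"
  by (simp add: cylinder_def)

lemma emeasure_cylinder: "emeasure lborel (cylinder w) = ennreal (1 / real (word_den w))"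
  by (simp add: cylinder_def)

text \<open>Countable additivity of Lebesgue measure on the partition of (0,1]. Sums over words are
  written as integrals for counting measure, which spares an enumeration of the words.\<close>

lemma sum_word_den:
  "(\<integral>\<^sup>+w. ennreal (1 / real (word_den w)) \<partial>count_space (luroth_words n)) = 1"
proof -
  have "emeasure lborel (\<Union>w\<in>luroth_words n. cylinder w) =
      (\<integral>\<^sup>+w. emeasure lborel (cylinder w) \<partial>count_space (luroth_words n))"
    by (intro emeasure_UN_countable disjoint_family_cylinder) (auto simp: cylinder_def)
  then show ?thesis by (simp add: UN_cylinder emeasure_cylinder)
qed

section \<open>Membership in the sets S_k\<close>

lemma mem_luroth_denoms:
  assumes "k \<ge> 1" "2 ^ (k - 1) dvd q" "2 ^ k \<le> q"
  shows "q \<in> luroth_denoms k"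
proof -
  obtain m where m: "q = 2 ^ (k - 1) * m" using assms(2) by blast
  have "(2::nat) ^ k = 2 ^ (k - 1) * 2" using assms(1) by (metis Suc_diff_1 less_eq_Suc_le One_nat_def power_Suc2)
  with assms(3) m have "m \<ge> 2" by simp
  \<comment> \<open>Digits 2 before position \<open>k\<close> contribute exactly the factor 2^(k-1);
    the last digit is then free to be the cofactor.\<close>
  define d where "d j = (if j = k then m else 2)" for j
  have "(\<Prod>j = 1..<k. d j * (d j - 1)) = (\<Prod>j = 1..<k. 2)"
    by (intro prod.cong) (auto simp: d_def)
  then have "luroth_denom d k = q"
    by (simp add: luroth_denom_def m d_def)
  moreover have "\<forall>j\<in>{1..k}. d j \<ge> 2" using \<open>m \<ge> 2\<close> by (simp add: d_def)
  ultimately show ?thesis unfolding luroth_denoms_def by blast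
qed

lemma word_den_mem_luroth_denoms:
  assumes "set u \<subseteq> {2..}" "m \<ge> 2" "1 \<le> k" "k \<le> Suc (length u)"
  shows "word_den u * m \<in> luroth_denoms k" "2 ^ Suc (length u) \<le> word_den u * m"
proof -
  have "2 ^ length u * 2 \<le> word_den u * m"
    using word_den_ge [OF assms(1)] assms(2) by (intro mult_mono) auto
  then show *: "2 ^ Suc (length u) \<le> word_den u * m" by simp
  have "(2::nat) ^ (k - 1) dvd 2 ^ length u" using assms by (intro le_imp_power_dvd) auto
  also have "\<dots> dvd word_den u * m" using power_dvd_word_den by simp
  finally have "2 ^ (k - 1) dvd word_den u * m" .
  moreover have "(2::nat) ^ k \<le> 2 ^ Suc (length u)" using assms by (intro power_increasing) auto
  ultimately show "word_den u * m \<in> luroth_denoms k"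
    using mem_luroth_denoms assms * by (meson order_trans)
qed

section \<open>Exponents\<close>

text \<open>S_k is unbounded. Along the trivial filter Limsup would be -\<infinity>, and the
  inequality Liminf \<le> Limsup, used for \<open>upper_lambda_nonneg\<close>, would fail.\<close>

lemma luroth_denoms_filter_neq_bot:
  assumes "k \<ge> 1"
  shows "inf sequentially (principal (luroth_denoms k)) \<noteq> bot"
proof
  assume "inf sequentially (principal (luroth_denoms k)) = bot"
  then have "eventually (\<lambda>_. False) (inf sequentially (principal (luroth_denoms k)))" by simp
  then obtain N where N: "\<And>q. q \<ge> N \<Longrightarrow> q \<notin> luroth_denoms k"
    by (auto simp: eventually_inf_principal eventually_sequentially)
  have "2 ^ (k - 1) * (N + 2) \<in> luroth_denoms k"
  proof (rule mem_luroth_denoms [OF assms])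
    have "(2::nat) ^ k = 2 ^ (k - 1) * 2"
      using assms by (metis Suc_diff_1 less_eq_Suc_le One_nat_def power_Suc2)
    then show "2 ^ k \<le> 2 ^ (k - 1) * (N + 2)" by simp
  qed simp
  moreover have "1 * N \<le> 2 ^ (k - 1) * (N + 2)" by (intro mult_mono) auto
  ultimately show False using N by simp
qed

lemma eventually_decay_rate_nonneg:
  assumes "\<And>q. q \<ge> 1 \<Longrightarrow> 0 < \<psi> q \<and> \<psi> q \<le> 1"
  shows "eventually (\<lambda>q. 0 \<le> decay_rate \<psi> q) (inf sequentially F)"
proof -
  have "eventually (\<lambda>q. 0 \<le> decay_rate \<psi> q) sequentially"
    using eventually_ge_at_top [of 1]
  proof eventually_elim
    case (elim q)
    then have "ln (\<psi> q) \<le> 0" using assms [OF elim] by simp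
    moreover have "0 \<le> ln (real q)" using elim by simp
    ultimately show ?case by (simp add: decay_rate_def divide_le_0_iff)
  qed
  then show ?thesis by (rule filter_leD [rotated]) simp
qed

lemma Liminf_le_of_filter_le: "F \<le> G \<Longrightarrow> Liminf G f \<le> Liminf F f"
  unfolding Liminf_def by (intro SUP_subset_mono) (auto dest: filter_leD)

lemma Limsup_le_of_filter_le: "F \<le> G \<Longrightarrow> Limsup F f \<le> Limsup G f"
  unfolding Limsup_def by (intro INF_superset_mono) (auto dest: filter_leD)

lemma lower_tau_le_lower_lambda: "lower_tau \<psi> \<le> lower_lambda \<psi>"
  unfolding lower_lambda_def lower_tau_def
  by (intro Liminf_bounded always_eventually allI Liminf_le_of_filter_le) simp

lemma upper_lambda_le_upper_tau: "upper_lambda \<psi> \<le> upper_tau \<psi>"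
proof -
  have "upper_lambda \<psi> \<le> liminf (\<lambda>k. limsup (decay_rate \<psi>))"
    unfolding upper_lambda_def
    by (intro Liminf_mono always_eventually allI Limsup_le_of_filter_le) simp
  then show ?thesis by (simp add: upper_tau_def Liminf_const)
qed

lemma lower_lambda_nonneg:
  assumes "\<And>q. q \<ge> 1 \<Longrightarrow> 0 < \<psi> q \<and> \<psi> q \<le> 1"
  shows "0 \<le> lower_lambda \<psi>"
  unfolding lower_lambda_def
  by (intro Liminf_bounded always_eventually allI eventually_decay_rate_nonneg assms)

lemma upper_lambda_nonneg:
  assumes "\<And>q. q \<ge> 1 \<Longrightarrow> 0 < \<psi> q \<and> \<psi> q \<le> 1"
  shows "0 \<le> upper_lambda \<psi>"
  unfolding upper_lambda_def
proof (rule Liminf_bounded)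
  show "\<forall>\<^sub>F k in sequentially. 0 \<le> Limsup (inf sequentially (principal (luroth_denoms k))) (decay_rate \<psi>)"
    using eventually_ge_at_top [of 1]
  proof eventually_elim
    case (elim k)
    have "0 \<le> Liminf (inf sequentially (principal (luroth_denoms k))) (decay_rate \<psi>)"
      by (intro Liminf_bounded eventually_decay_rate_nonneg assms)
    also have "\<dots> \<le> Limsup (inf sequentially (principal (luroth_denoms k))) (decay_rate \<psi>)"
      using luroth_denoms_filter_neq_bot [OF elim] by (rule Liminf_le_Limsup)
    finally show ?case .
  qed
qed

text \<open>Length alone controls both conditions on \<open>q = word_den u * m\<close>: it forces
  \<open>q\<close> into S_k, and it makes \<open>q\<close> large because \<open>q\<close> is at
  least 2 to the power \<open>Suc (length u)\<close>. The threshold therefore does not depend on the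
  point \<open>x\<close>.\<close>

lemma eventually_luroth_denoms_words:
  assumes "eventually P (inf sequentially (principal (luroth_denoms k)))" "k \<ge> 1"
  shows "\<exists>N. \<forall>u m. N \<le> length u \<longrightarrow> set (u @ [m]) \<subseteq> {2..} \<longrightarrow> P (word_den u * m)"
proof -
  from assms(1) obtain M where M: "\<And>q. q \<ge> M \<Longrightarrow> q \<in> luroth_denoms k \<Longrightarrow> P q"
    by (auto simp: eventually_inf_principal eventually_sequentially)
  show ?thesis
  proof (intro exI [of _ "max M k"] allI impI)
    fix u :: "nat list" and m :: nat assume u: "max M k \<le> length u" "set (u @ [m]) \<subseteq> {2..}"
    have "M \<le> length u" using u by simp
    also have "length u \<le> 2 ^ Suc (length u)"
      by (metis less_exp less_imp_le Suc_lessD)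
    also have "\<dots> \<le> word_den u * m" using word_den_mem_luroth_denoms(2) [of u m 1] u by simp
    finally show "P (word_den u * m)"
      using M word_den_mem_luroth_denoms(1) [of u m k] u assms(2) by simp
  qed
qed

lemma less_lower_lambdaD:
  assumes \<psi>: "\<And>q. q \<ge> 1 \<Longrightarrow> 0 < \<psi> q \<and> \<psi> q \<le> 1" and t: "ereal t < lower_lambda \<psi>"
  obtains N where "\<And>u m. N \<le> length u \<Longrightarrow> set (u @ [m]) \<subseteq> {2..} \<Longrightarrow>
      \<psi> (word_den u * m) \<le> real (word_den u * m) powr (- t)"
proof -
  have "\<forall>\<^sub>F k in sequentially. k \<ge> 1 \<and>
      ereal t < Liminf (inf sequentially (principal (luroth_denoms k))) (decay_rate \<psi>)"
    using less_LiminfD [OF t [unfolded lower_lambda_def]] eventually_ge_at_top [of 1]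
    by eventually_elim simp
  then obtain k where k: "k \<ge> 1"
    "ereal t < Liminf (inf sequentially (principal (luroth_denoms k))) (decay_rate \<psi>)"
    by (auto simp: eventually_sequentially)
  from eventually_luroth_denoms_words [OF less_LiminfD [OF k(2)] k(1)]
  obtain N where N: "\<And>u m. N \<le> length u \<Longrightarrow> set (u @ [m]) \<subseteq> {2..} \<Longrightarrow>
      ereal t < decay_rate \<psi> (word_den u * m)"
    by blast
  show thesis
  proof (rule that [of N])
    fix u :: "nat list" and m :: nat assume u: "N \<le> length u" "set (u @ [m]) \<subseteq> {2..}"
    define q where "q = word_den u * m"
    have "1 * 2 \<le> word_den u * m"
      using word_den_pos [of u] u(2) by (intro mult_mono) auto
    then have q: "q \<ge> 2" by (simp add: q_def)
    then have ln: "ln (real q) > 0" by simp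
    have "t < - ln (\<psi> q) / ln (real q)" using N [OF u] by (simp add: decay_rate_def q_def)
    then have "ln (\<psi> q) < - t * ln (real q)" using ln by (simp only: pos_less_divide_eq)
    then have "exp (ln (\<psi> q)) < exp (- t * ln (real q))" by (rule exp_less_mono)
    then show "\<psi> q \<le> real q powr (- t)"
      using \<psi> [of q] q by (simp add: powr_def)
  qed
qed

lemma upper_lambda_lessD:
  assumes \<psi>: "\<And>q. q \<ge> 1 \<Longrightarrow> 0 < \<psi> q \<and> \<psi> q \<le> 1" and t: "upper_lambda \<psi> < ereal t"
  obtains N where "\<And>u m. N \<le> length u \<Longrightarrow> set (u @ [m]) \<subseteq> {2..} \<Longrightarrow>
      real (word_den u * m) powr (- t) < \<psi> (word_den u * m)"
proof -
  \<comment> \<open>One good \<open>k\<close> suffices, since the denominators of all sufficiently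
    long words lie in that single S_k.\<close>
  have "\<exists>k\<ge>1. Limsup (inf sequentially (principal (luroth_denoms k))) (decay_rate \<psi>) < ereal t"
  proof (rule ccontr)
    assume "\<not> ?thesis"
    then have "ereal t \<le> upper_lambda \<psi>"
      unfolding upper_lambda_def
      by (intro Liminf_bounded eventually_sequentiallyI [of 1]) auto
    then show False using t by simp
  qed
  then obtain k where k: "k \<ge> 1"
    "Limsup (inf sequentially (principal (luroth_denoms k))) (decay_rate \<psi>) < ereal t" by blast
  from eventually_luroth_denoms_words [OF Limsup_lessD [OF k(2)] k(1)]
  obtain N where N: "\<And>u m. N \<le> length u \<Longrightarrow> set (u @ [m]) \<subseteq> {2..} \<Longrightarrow>
      decay_rate \<psi> (word_den u * m) < ereal t"
    by blast
  show thesis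
  proof (rule that [of N])
    fix u :: "nat list" and m :: nat assume u: "N \<le> length u" "set (u @ [m]) \<subseteq> {2..}"
    define q where "q = word_den u * m"
    have "1 * 2 \<le> word_den u * m"
      using word_den_pos [of u] u(2) by (intro mult_mono) auto
    then have q: "q \<ge> 2" by (simp add: q_def)
    then have ln: "ln (real q) > 0" by simp
    have "- ln (\<psi> q) / ln (real q) < t" using N [OF u] by (simp add: decay_rate_def q_def)
    then have "- t * ln (real q) < ln (\<psi> q)" using ln by (simp only: pos_divide_less_eq)
    then have "exp (- t * ln (real q)) < exp (ln (\<psi> q))" by (rule exp_less_mono)
    then show "real q powr (- t) < \<psi> q"
      using \<psi> [of q] q by (simp add: powr_def)
  qed
qed

section \<open>Upper bound\<close>

text \<open>Admits covers indexed by any subset of a countable type. Indices are sent to naturals by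
  \<open>to_nat\<close> and the gaps are filled with empty sets, which have weight 0 and, as
  \<open>0 \<le> \<delta>\<close>, admissible diameter.\<close>

lemma hausdorff_premeasure_le:
  fixes V :: "'i::countable \<Rightarrow> 'a::metric_space set"
  assumes cover: "A \<subseteq> (\<Union>i\<in>I. V i)"
    and bdd: "\<And>i. i \<in> I \<Longrightarrow> bounded (V i)"
    and diam: "\<And>i. i \<in> I \<Longrightarrow> diameter (V i) \<le> \<delta>"
    and "0 \<le> \<delta>"
  shows "hausdorff_premeasure s \<delta> A \<le> (\<integral>\<^sup>+i. hausdorff_weight s (V i) \<partial>count_space I)"
proof -
  define U where "U n = (if n \<in> to_nat ` I then V (from_nat n) else {})" for n
  have U: "U (to_nat i) = V i" if "i \<in> I" for i using that by (simp add: U_def)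
  have "V i \<subseteq> (\<Union>n. U n)" if "i \<in> I" for i
    unfolding U [OF that, symmetric] by (rule UN_upper) simp
  then have "A \<subseteq> (\<Union>n. U n)" using cover by (meson UN_least order_trans)
  moreover have "bounded (U n) \<and> diameter (U n) \<le> \<delta>" for n
    using bdd diam \<open>0 \<le> \<delta>\<close> by (auto simp: U_def)
  ultimately have "hausdorff_premeasure s \<delta> A \<le> (\<Sum>n. hausdorff_weight s (U n))"
    unfolding hausdorff_premeasure_def by (intro INF_lower) simp
  also have "\<dots> = (\<integral>\<^sup>+n. hausdorff_weight s (U n) \<partial>count_space UNIV)"
    by (simp add: nn_integral_count_space_nat)
  also have "\<dots> = (\<integral>\<^sup>+n. hausdorff_weight s (U n) \<partial>count_space (to_nat ` I))"
    by (rule nn_integral_count_space_eq) (auto simp: U_def hausdorff_weight_def)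
  also have "\<dots> = (\<integral>\<^sup>+i. hausdorff_weight s (U (to_nat i)) \<partial>count_space I)"
    by (rule nn_integral_bij_count_space [symmetric]) (simp add: inj_on_imp_bij_betw)
  also have "\<dots> = (\<integral>\<^sup>+i. hausdorff_weight s (V i) \<partial>count_space I)"
    by (intro nn_integral_cong) (simp add: U)
  finally show ?thesis .
qed

text \<open>Write D^(-s) = D^(1-s) * D^(-1) with D = \<open>word_den u\<close>. As D \<ge> 2^n and
  \<open>1 \<le> s\<close>, the first factor is at most 2^(n(1-s)); the second sums to 1.\<close>

lemma sum_word_den_powr:
  assumes "1 \<le> s"
  shows "(\<integral>\<^sup>+u. ennreal (real (word_den u) powr (- s)) \<partial>count_space (luroth_words n))
    \<le> ennreal ((2 powr (1 - s)) ^ n)"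
proof -
  have "(\<integral>\<^sup>+u. ennreal (real (word_den u) powr (- s)) \<partial>count_space (luroth_words n))
    \<le> (\<integral>\<^sup>+u. ennreal ((2 powr (1 - s)) ^ n) * ennreal (1 / real (word_den u)) \<partial>count_space (luroth_words n))"
  proof (intro nn_integral_mono)
    fix u assume "u \<in> space (count_space (luroth_words n))"
    then have u: "2 ^ n \<le> word_den u" "0 < word_den u" using mem_luroth_wordsD by auto
    have "2 ^ n \<le> real (word_den u)" using u(1) by (metis of_nat_le_iff of_nat_numeral of_nat_power)
    then have "real (word_den u) powr (1 - s) \<le> (2 ^ n) powr (1 - s)"
      using assms by (intro powr_mono2') auto
    also have "\<dots> = (2 powr (1 - s)) ^ n"
      by (simp add: powr_powr powr_realpow [symmetric] mult.commute)
    finally have "real (word_den u) powr (1 - s) / real (word_den u) \<le>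
        (2 powr (1 - s)) ^ n / real (word_den u)"
      by (intro divide_right_mono) auto
    moreover have "real (word_den u) powr (- s) = real (word_den u) powr (1 - s) / real (word_den u)"
      using u by (simp add: powr_diff powr_minus_divide)
    ultimately show "ennreal (real (word_den u) powr (- s)) \<le>
        ennreal ((2 powr (1 - s)) ^ n) * ennreal (1 / real (word_den u))"
      by (simp add: ennreal_mult [symmetric] ennreal_leI)
  qed
  also have "\<dots> = ennreal ((2 powr (1 - s)) ^ n)"
    by (simp add: nn_integral_cmult sum_word_den)
  finally show ?thesis .
qed

text \<open>With s' = s(1+t) > 1, the interval of \<open>u @ [m]\<close> has weight
  \<open>(word_den u * m) powr (- s')\<close>, a product. The digits \<open>m\<close> sum to at most
  a convergent zeta value, the words \<open>u\<close> of length \<open>n\<close> to at most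
  \<beta>^n, and using only lengths from \<open>N\<close> on leaves a geometric tail.\<close>

lemma hausdorff_measure_luroth_approx_set_eq_0:
  assumes N0: "\<And>u m. N0 \<le> length u \<Longrightarrow> set (u @ [m]) \<subseteq> {2..} \<Longrightarrow>
      \<psi> (word_den u * m) \<le> real (word_den u * m) powr (- t)"
    and t: "0 \<le> t" and s: "1 < s * (1 + t)"
  shows "hausdorff_measure s (luroth_approx_set \<psi>) = 0"
proof -
  define s' where "s' = s * (1 + t)"
  define \<beta> where "\<beta> = 2 powr (1 - s')"
  have s': "1 < s'" using s by (simp add: s'_def)
  have \<beta>: "0 < \<beta>" "\<beta> < 1" using s' by (auto simp: \<beta>_def powr_less_one)
  have "0 < s" using s t by (smt (verit) mult_nonpos_nonneg)
  \<comment> \<open>The term at \<open>m = 0\<close> vanishes because \<open>0 powr _ = 0\<close>,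
    so \<open>Z\<close> is zeta(s').\<close>
  define Z where "Z = (\<Sum>m. real m powr (- s'))"
  have sumZ: "summable (\<lambda>m. real m powr (- s'))" using s' by (simp add: summable_real_powr_iff)
  have Z: "(\<integral>\<^sup>+m. ennreal (real m powr (- s')) \<partial>count_space UNIV) = ennreal Z"
    using sumZ by (simp add: nn_integral_count_space_nat Z_def suminf_ennreal2)
  have Z0: "0 \<le> Z" unfolding Z_def by (intro suminf_nonneg sumZ) simp
  define r where "r q = real q powr (- (1 + t))" for q :: nat
  have r_le: "r q \<le> 1 / real q" if "q \<ge> 1" for q
  proof -
    have "r q \<le> real q powr (- 1)" unfolding r_def using that t by (intro powr_mono) auto
    then show ?thesis using that by (simp add: powr_minus_divide)
  qed
  have r_s: "r q powr s = real q powr (- s')" for q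
  proof -
    have "- (1 + t) * s = - s'" by (simp add: s'_def algebra_simps)
    then show ?thesis unfolding r_def powr_powr by (rule arg_cong)
  qed
  have pre: "hausdorff_premeasure s \<delta> (luroth_approx_set \<psi>) \<le> ennreal (\<beta> ^ N / (1 - \<beta>) * Z)"
    if N: "N0 \<le> N" "1 / 2 ^ N \<le> \<delta>" and \<delta>: "0 < \<delta>" for \<delta> N
  proof -
    define I where "I = {(n, u, m). N \<le> n \<and> u \<in> luroth_words n \<and> (2::nat) \<le> m}"
    \<comment> \<open>One-sided intervals suffice: the points of a cylinder lie to the right of its
      \<open>word_val\<close>.\<close>
    define V where "V = (\<lambda>(n::nat, u, m). {word_val (u @ [m]) .. word_val (u @ [m]) + r (word_den u * m)})"
    define G :: "nat \<Rightarrow> ennreal" where "G n = indicator {N..} n" for n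
    define H where "H n u = ennreal (real (word_den u) powr (- s')) * indicator (luroth_words n) u" for n u
    define K where "K m = ennreal (real m powr (- s'))" for m
    have den: "word_den u * m \<ge> 2 ^ N" if "(n, u, m) \<in> I" for n u m
    proof -
      have "set u \<subseteq> {2..}" "m \<ge> 2" "N \<le> length u"
        using that mem_luroth_wordsD [of u n] by (auto simp: I_def)
      then have "2 ^ Suc (length u) \<le> word_den u * m"
        using word_den_mem_luroth_denoms(2) [of u m 1] by simp
      moreover have "(2::nat) ^ N \<le> 2 ^ Suc (length u)"
        using \<open>N \<le> length u\<close> by (intro power_increasing) auto
      ultimately show ?thesis by linarith
    qed
    have cover: "luroth_approx_set \<psi> \<subseteq> (\<Union>i\<in>I. V i)"
    proof
      fix x assume "x \<in> luroth_approx_set \<psi>"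
      then obtain u m where um: "N \<le> length u" "set (u @ [m]) \<subseteq> {2..}" "x \<in> cylinder (u @ [m])"
        "\<bar>x - word_val (u @ [m])\<bar> < \<psi> (word_den u * m) / real (word_den u * m)"
        unfolding mem_luroth_approx_set_iff by blast
      define q where "q = word_den u * m"
      have I: "(length u, u, m) \<in> I" using um by (simp add: I_def luroth_words_def)
      have "(1::nat) \<le> 2 ^ N" by simp
      with den [OF I] have q: "q \<ge> 1" unfolding q_def by linarith
      have "\<psi> q / real q \<le> real q powr (- t) / real q"
        using N0 [of u m] um N unfolding q_def by (intro divide_right_mono) auto
      also have "\<dots> = r q" using q by (simp add: r_def powr_diff powr_minus_divide powr_add)
      finally have "x \<in> V (length u, u, m)"
        using um(3,4) by (auto simp: V_def cylinder_def q_def [symmetric])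
      with I show "x \<in> (\<Union>i\<in>I. V i)" by blast
    qed
    have r0: "0 \<le> r q" for q by (simp add: r_def)
    have diam: "diameter (V i) \<le> \<delta>" if "i \<in> I" for i
    proof -
      obtain n u m where i: "i = (n, u, m)" by (cases i)
      have q: "2 ^ N \<le> word_den u * m" using den that i by blast
      then have q': "2 ^ N \<le> real (word_den u * m)" by (metis of_nat_le_iff of_nat_numeral of_nat_power)
      have "(1::nat) \<le> 2 ^ N" by simp
      then have "r (word_den u * m) \<le> 1 / real (word_den u * m)" using q by (intro r_le) linarith
      also have "\<dots> \<le> 1 / 2 ^ N" using q' by (intro frac_le) auto
      finally show ?thesis using N \<delta> by (simp add: i V_def)
    qed
    have "hausdorff_premeasure s \<delta> (luroth_approx_set \<psi>) \<le>
        (\<integral>\<^sup>+i. hausdorff_weight s (V i) \<partial>count_space I)"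
      using cover by (rule hausdorff_premeasure_le) (use diam \<delta> in \<open>auto simp: V_def\<close>)
    also have "\<dots> = (\<integral>\<^sup>+i. hausdorff_weight s (V i) * indicator I i \<partial>count_space UNIV)"
      by (rule nn_integral_count_space_indicator) simp
    also have "\<dots> \<le> (\<integral>\<^sup>+i. (case i of (n, u, m) \<Rightarrow> G n * (H n u * K m)) \<partial>count_space UNIV)"
    proof (intro nn_integral_mono)
      fix i :: "nat \<times> nat list \<times> nat"
      obtain n u m where i: "i = (n, u, m)" by (cases i)
      show "hausdorff_weight s (V i) * indicator I i \<le> (case i of (n, u, m) \<Rightarrow> G n * (H n u * K m))"
      proof (cases "i \<in> I")
        case True
        then have "G n = 1" "indicator (luroth_words n) u = (1::ennreal)"
          by (auto simp: G_def I_def i)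
        moreover have "hausdorff_weight s (V i) =
            ennreal (real (word_den u) powr (- s')) * ennreal (real m powr (- s'))"
          using r0 [of "word_den u * m"] \<open>0 < s\<close>
          by (simp add: hausdorff_weight_def V_def i r_s powr_mult ennreal_mult)
        ultimately show ?thesis using True by (simp add: i H_def K_def)
      qed simp
    qed
    also have "\<dots> = (\<integral>\<^sup>+n. \<integral>\<^sup>+u. \<integral>\<^sup>+m. G n * (H n u * K m)
        \<partial>count_space UNIV \<partial>count_space UNIV \<partial>count_space UNIV)"
      by (simp add: nn_integral_fst_count_space [symmetric])
    also have "\<dots> = (\<integral>\<^sup>+n. G n * ((\<integral>\<^sup>+u. H n u \<partial>count_space UNIV) * ennreal Z) \<partial>count_space UNIV)"
      by (simp add: nn_integral_cmult nn_integral_multc K_def Z)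
    also have "\<dots> \<le> (\<integral>\<^sup>+n. G n * (ennreal (\<beta> ^ n) * ennreal Z) \<partial>count_space UNIV)"
    proof (intro nn_integral_mono mult_left_mono mult_right_mono)
      fix n :: nat
      have "(\<integral>\<^sup>+u. H n u \<partial>count_space UNIV) =
          (\<integral>\<^sup>+u. ennreal (real (word_den u) powr (- s')) \<partial>count_space (luroth_words n))"
        unfolding H_def by (rule nn_integral_count_space_indicator [symmetric]) simp
      also have "\<dots> \<le> ennreal (\<beta> ^ n)"
        unfolding \<beta>_def using s' by (intro sum_word_den_powr) simp
      finally show "(\<integral>\<^sup>+u. H n u \<partial>count_space UNIV) \<le> ennreal (\<beta> ^ n)" .
    qed simp_all
    also have "\<dots> = (\<Sum>n. G n * ennreal (\<beta> ^ n * Z))"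
      using \<beta> Z0 by (simp add: nn_integral_count_space_nat ennreal_mult)
    also have "\<dots> = (\<Sum>n. ennreal (\<beta> ^ (n + N) * Z))"
    proof -
      have "(\<Sum>n. G n * ennreal (\<beta> ^ n * Z)) = (\<Sum>n. G (n + N) * ennreal (\<beta> ^ (n + N) * Z))"
        by (subst suminf_offset [of _ N]) (auto simp: G_def)
      then show ?thesis by (simp add: G_def)
    qed
    also have "\<dots> = ennreal (\<Sum>n. \<beta> ^ n * (\<beta> ^ N * Z))"
      using \<beta> Z0 by (subst suminf_ennreal2)
        (auto simp: power_add mult.assoc intro!: summable_mult2 summable_geometric)
    also have "(\<Sum>n. \<beta> ^ n * (\<beta> ^ N * Z)) = \<beta> ^ N / (1 - \<beta>) * Z"
      using \<beta> by (subst suminf_mult2 [symmetric]) (auto simp: suminf_geometric summable_geometric)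
    finally show ?thesis .
  qed
  \<comment> \<open>For fixed \<delta> the bound holds for every large \<open>N\<close> and tends to
    0.\<close>
  have "hausdorff_premeasure s \<delta> (luroth_approx_set \<psi>) \<le> 0" if \<delta>: "0 < \<delta>" for \<delta>
  proof (rule tendsto_lowerbound)
    have "(\<lambda>N. \<beta> ^ N / (1 - \<beta>) * Z) \<longlonglongrightarrow> 0 / (1 - \<beta>) * Z"
      using \<beta> by (intro tendsto_intros LIMSEQ_power_zero) auto
    then show "(\<lambda>N. ennreal (\<beta> ^ N / (1 - \<beta>) * Z)) \<longlonglongrightarrow> 0"
      using tendsto_ennrealI by fastforce
    have "eventually (\<lambda>N. 1 / 2 ^ N < \<delta>) sequentially"
      using LIMSEQ_inverse_realpow_zero [of 2] \<delta>
      by (intro order_tendstoD) (auto simp: inverse_eq_divide)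
    then show "eventually (\<lambda>N. hausdorff_premeasure s \<delta> (luroth_approx_set \<psi>) \<le>
        ennreal (\<beta> ^ N / (1 - \<beta>) * Z)) sequentially"
      using eventually_ge_at_top [of N0] by eventually_elim (use pre \<delta> in auto)
  qed simp
  then have "hausdorff_measure s (luroth_approx_set \<psi>) \<le> 0"
    unfolding hausdorff_measure_def by (intro SUP_least) simp
  then show ?thesis by simp
qed

section \<open>Lower bound\<close>

text \<open>Each covering set lies in the ball about one of its points whose radius is its diameter.
  Enlarging the radii slightly makes them positive, and raising the exponent to
  \<open>s' > 0\<close> removes the special weight at \<open>s = 0\<close>.\<close>

lemma hausdorff_measure_eq_0_cball_cover:
  fixes A :: "'a::metric_space set"
  assumes H: "hausdorff_measure s A = 0" and s: "0 \<le> s" "s \<le> s'" "0 < s'" and e: "0 < e"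
  obtains r c where "\<forall>i::nat. 0 < r i" "A \<subseteq> (\<Union>i. cball (c i) (r i))"
    "(\<Sum>i. ennreal (r i powr s')) \<le> ennreal e"
proof -
  have "hausdorff_premeasure s 1 A \<le> hausdorff_measure s A"
    unfolding hausdorff_measure_def by (intro SUP_upper) simp
  then have "hausdorff_premeasure s 1 A < ennreal (e / 2)" using H e by simp
  then obtain U :: "nat \<Rightarrow> 'a set" where U: "A \<subseteq> (\<Union>i. U i)"
    "\<And>i. bounded (U i)" "\<And>i. diameter (U i) \<le> 1"
    "(\<Sum>i. hausdorff_weight s (U i)) < ennreal (e / 2)"
    unfolding hausdorff_premeasure_def INF_less_iff by blast
  \<comment> \<open>Chosen so that the sum of \<open>\<gamma> i powr s'\<close> is
    \<open>e / 2\<close>; the other half of \<open>e\<close> pays for the diameters.\<close>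
  define \<gamma> where "\<gamma> i = (e / 2 * (1 / 2) ^ Suc i) powr (1 / s')" for i
  have \<gamma>: "0 < \<gamma> i" "\<gamma> i powr s' = e / 2 * (1 / 2) ^ Suc i" for i
    using e s by (auto simp: \<gamma>_def powr_powr)
  define r where "r i = max (diameter (U i)) (\<gamma> i)" for i
  define c where "c i = (SOME x. x \<in> U i)" for i
  have d0: "0 \<le> diameter (U i)" for i using U(2) by (rule diameter_ge_0)
  have "U i \<subseteq> cball (c i) (r i)" for i
  proof
    fix x assume x: "x \<in> U i"
    then have "c i \<in> U i" unfolding c_def by (rule someI)
    then have "dist (c i) x \<le> diameter (U i)" using diameter_bounded_bound [OF U(2)] x by blast
    then show "x \<in> cball (c i) (r i)" by (simp add: r_def)
  qed
  then have cover: "A \<subseteq> (\<Union>i. cball (c i) (r i))"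
    by (intro order_trans [OF U(1)] UN_mono) auto
  have w: "ennreal (r i powr s') \<le> hausdorff_weight s (U i) + ennreal (e / 2 * (1 / 2) ^ Suc i)" for i
  proof -
    have "r i powr s' \<le> diameter (U i) powr s' + e / 2 * (1 / 2) ^ Suc i"
    proof -
      have "0 \<le> e / 2 * (1 / 2) ^ Suc i" using e by simp
      then have "max (diameter (U i) powr s') (\<gamma> i powr s') \<le> diameter (U i) powr s' + e / 2 * (1 / 2) ^ Suc i"
        using \<gamma>(2) [of i] powr_ge_zero [of "diameter (U i)" s'] by linarith
      then show ?thesis by (auto simp: r_def max_def split: if_splits)
    qed
    then have "ennreal (r i powr s') \<le>
        ennreal (diameter (U i) powr s') + ennreal (e / 2 * (1 / 2) ^ Suc i)"
      using e by (simp add: ennreal_plus [symmetric] ennreal_leI del: ennreal_plus)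
    \<comment> \<open>This is where \<open>diameter (U i) \<le> 1\<close> matters: raising the
      exponent does not increase the power, and at \<open>s = 0\<close> the weight 1 of a nonempty
      set dominates.\<close>
    moreover have "ennreal (diameter (U i) powr s') \<le> hausdorff_weight s (U i)"
      using d0 [of i] U(3) [of i] s
      by (auto simp: hausdorff_weight_def powr_le1 intro!: ennreal_leI powr_mono')
    ultimately show ?thesis by (meson add_right_mono order_trans)
  qed
  have "(\<Sum>i. ennreal (r i powr s')) \<le>
      (\<Sum>i. hausdorff_weight s (U i) + ennreal (e / 2 * (1 / 2) ^ Suc i))"
    by (intro suminf_le w) auto
  also have "\<dots> = (\<Sum>i. hausdorff_weight s (U i)) + (\<Sum>i. ennreal (e / 2 * (1 / 2) ^ Suc i))"
    by (intro suminf_add [symmetric]) auto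
  also have "(\<Sum>i. ennreal (e / 2 * (1 / 2) ^ Suc i)) = ennreal (e / 2)"
    using sums_mult [OF power_half_series, of "e / 2"] e
    by (intro suminf_ennreal_eq) auto
  also have "(\<Sum>i. hausdorff_weight s (U i)) + ennreal (e / 2) \<le> ennreal (e / 2) + ennreal (e / 2)"
    using U(4) by (intro add_right_mono) simp
  also have "\<dots> = ennreal e" using e by (simp add: ennreal_plus [symmetric] del: ennreal_plus)
  finally have sum: "(\<Sum>i. ennreal (r i powr s')) \<le> ennreal e" .
  have "\<forall>i. 0 < r i" using \<gamma>(1) by (simp add: r_def less_max_iff_disj)
  then show thesis using cover sum by (rule that)
qed

section \<open>Costs of ball covers and approximation intervals\<close>

definition ball_cost :: "(nat \<Rightarrow> real) \<Rightarrow> (nat \<Rightarrow> real) \<Rightarrow> real \<Rightarrow> real set \<Rightarrow> ennreal" where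
  "ball_cost c r s I = (\<Sum>i. if cball (c i) (r i) \<inter> I = {} then 0 else ennreal (r i powr s))"

text \<open>The next digit after \<open>u\<close> is fixed as 2, so Q =
  \<open>word_den u * 2\<close> and the radius is Q^(-(1+t)), which is \<psi>(Q)/Q for the model
  function \<psi>(q) = q^(-t).\<close>

definition approx_radius :: "real \<Rightarrow> nat list \<Rightarrow> real" where
  "approx_radius t u = real (word_den u * 2) powr (- (1 + t))"

text \<open>Only the right half of the approximation range: it is compact, as the nested
  intersection needs, and avoids P/Q, which the left-open cylinder excludes.\<close>

definition approx_interval :: "real \<Rightarrow> nat list \<Rightarrow> real set" where
  "approx_interval t u =
     {word_val (u @ [2]) + approx_radius t u / 2 .. word_val (u @ [2]) + approx_radius t u}"

lemma le_suminf_ennreal: "f i \<le> (\<Sum>i. f i)" for f :: "nat \<Rightarrow> ennreal"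
  using sum_le_suminf [of f "{i}"] by simp

lemma ball_cost_ge:
  assumes "cball (c i) (r i) \<inter> I \<noteq> {}"
  shows "ennreal (r i powr s) \<le> ball_cost c r s I"
  using assms le_suminf_ennreal [of "\<lambda>i. if cball (c i) (r i) \<inter> I = {} then 0 else ennreal (r i powr s)" i]
  by (simp add: ball_cost_def)

lemma ball_cost_radius_le:
  assumes "cball (c i) (r i) \<inter> I \<noteq> {}" "ball_cost c r s I \<le> ennreal (L powr s)"
    "0 < s" "0 \<le> L" "0 \<le> r i"
  shows "r i \<le> L"
proof -
  have "ennreal (r i powr s) \<le> ennreal (L powr s)"
    using ball_cost_ge [where c = c and r = r and i = i, OF assms(1)] assms(2) by (rule order_trans)
  then have "r i powr s \<le> L powr s" by simp
  then show ?thesis using assms(3-5) by (meson not_le powr_less_mono2)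
qed

text \<open>Since 2(2-1) = 2, the cylinder of \<open>u @ [2]\<close> is exactly the right half of
  that of \<open>u\<close>, of length 1/Q. As \<open>0 \<le> t\<close>, the radius Q^(-(1+t)) is no
  longer than that.\<close>

lemma approx_interval_subset:
  assumes "set u \<subseteq> {2..}" "0 \<le> t"
  shows "0 < approx_radius t u" "approx_radius t u \<le> 1 / real (word_den u * 2)"
    "approx_interval t u \<subseteq> cylinder (u @ [2])" "cylinder (u @ [2]) \<subseteq> cylinder u"
proof -
  have q: "1 \<le> real (word_den u * 2)" using word_den_pos [OF assms(1)] by simp
  then show 0: "0 < approx_radius t u" by (simp add: approx_radius_def)
  have "approx_radius t u \<le> real (word_den u * 2) powr (- 1)"
    unfolding approx_radius_def using q assms by (intro powr_mono) auto
  then show 1: "approx_radius t u \<le> 1 / real (word_den u * 2)"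
    using q by (simp add: powr_minus_divide)
  show "approx_interval t u \<subseteq> cylinder (u @ [2])"
    using 0 1 by (auto simp: approx_interval_def cylinder_def)
  show "cylinder (u @ [2]) \<subseteq> cylinder u"
  proof -
    define D where "D = 1 / real (word_den u)"
    have "0 < D" using word_den_pos [OF assms(1)] by (simp add: D_def)
    moreover have "1 / real (word_den u * 2) = D / 2" "1 / real (word_den (u @ [2])) = D / 2"
      by (simp_all add: D_def)
    ultimately show ?thesis
      unfolding cylinder_def word_val_snoc D_def [symmetric] by auto
  qed
qed

lemma emeasure_half_open_inter_cball_ge:
  fixes p l y c r :: real
  assumes y: "y \<in> {p <.. p + l}" "y \<in> cball c r" and r: "0 < r" "2 * r < l"
  shows "ennreal (2 * r) \<le> emeasure lborel ({p <.. p + l} \<inter> cball c (3 * r))"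
proof -
  \<comment> \<open>A window of length \<open>2 * r\<close> ending at \<open>y\<close>, pushed right
    if it would cross \<open>p\<close>. It stays within \<open>2 * r\<close> of \<open>y\<close>,
    hence within \<open>3 * r\<close> of \<open>c\<close>.\<close>
  define z where "z = max p (y - 2 * r)"
  have "{z <.. z + 2 * r} \<subseteq> {p <.. p + l} \<inter> cball c (3 * r)"
    using assms by (auto simp: z_def dist_real_def max_def abs_if split: if_splits)
  then have "emeasure lborel {z <.. z + 2 * r} \<le> emeasure lborel ({p <.. p + l} \<inter> cball c (3 * r))"
    by (intro emeasure_mono) auto
  then show ?thesis using r by simp
qed

text \<open>
  An approximation interval has length \<open>approx_radius t u / 2\<close>, whence the constant 200 below against
  the 100 for the parent interval.
\<close>

lemma exists_cheap_approx_interval: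
  assumes r: "\<And>i. 0 < r i" and t: "0 \<le> t" and s: "0 < s" "s * (1 + t) < 1"
    and ab: "a < b" "{a..b} \<subseteq> {0<..1}"
    and cost: "ball_cost c r s {a..b} \<le> ennreal (((b - a) / 100) powr s)"
  obtains u where "N \<le> length u" "set u \<subseteq> {2..}" "approx_interval t u \<subseteq> {a..b}"
    "ball_cost c r s (approx_interval t u) \<le> ennreal ((approx_radius t u / 200) powr s)"
proof -
  define \<eta> where "\<eta> = 1 - s * (1 + t)"
  have \<eta>: "0 < \<eta>" using s by (simp add: \<eta>_def)
  have s1: "s < 1" using s t by (smt (verit) mult_left_mono mult_cancel_left2)
  define l where "l = b - a"
  have l: "0 < l" using ab by (simp add: l_def)
  \<comment> \<open>Bounds the length of \<open>J u\<close> relative to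
    \<open>(approx_radius t u / 200) powr s\<close>: with q = \<open>word_den u * 2\<close> the
    ratio is \<open>200 powr s * (1 / q) powr \<eta>\<close>, and q \<ge> 2^n. It tends to 0 because
    \<eta> > 0.\<close>
  define \<epsilon> where "\<epsilon> n = 200 powr s * (1 / 2 ^ n) powr \<eta>" for n :: nat
  have lim: "(\<lambda>n. 1 / 2 ^ n :: real) \<longlonglongrightarrow> 0"
    using LIMSEQ_inverse_realpow_zero [of 2] by (simp add: inverse_eq_divide)
  have "(\<lambda>n. 6 * \<epsilon> n * (l / 100) powr s) \<longlonglongrightarrow> 6 * (200 powr s * 0 powr \<eta>) * (l / 100) powr s"
    unfolding \<epsilon>_def using \<eta> lim by (intro tendsto_intros tendsto_powr') auto
  from order_tendstoD(2) [OF this, of "l / 10"]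
  have "eventually (\<lambda>n. 6 * \<epsilon> n * (l / 100) powr s < l / 10) sequentially"
    using l by simp
  moreover have "eventually (\<lambda>n. 1 / 2 ^ n < l / 4) sequentially"
    using order_tendstoD(2) [OF lim, of "l / 4"] l by simp
  moreover note eventually_ge_at_top [of N]
  ultimately have "eventually (\<lambda>n. 6 * \<epsilon> n * (l / 100) powr s < l / 10 \<and> 1 / 2 ^ n < l / 4 \<and> N \<le> n) sequentially"
    by eventually_elim simp
  then obtain n where n: "6 * \<epsilon> n * (l / 100) powr s < l / 10" "1 / 2 ^ n < l / 4" "N \<le> n"
    by (auto simp: eventually_sequentially)
  define W where "W = {u \<in> luroth_words n. cylinder u \<subseteq> {a..b}}"
  have Wc: "countable W" by simp
  have W: "length u = n" "set u \<subseteq> {2..}" "2 ^ n \<le> real (word_den u)" "0 < word_den u"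
    "cylinder u \<subseteq> {a..b}" if "u \<in> W" for u
  proof -
    have "u \<in> luroth_words n" "cylinder u \<subseteq> {a..b}" using that by (auto simp: W_def)
    then show "length u = n" "set u \<subseteq> {2..}" "0 < word_den u" "cylinder u \<subseteq> {a..b}"
      using mem_luroth_wordsD by auto
    have "2 ^ n \<le> word_den u" using \<open>u \<in> luroth_words n\<close> by (rule mem_luroth_wordsD)
    then show "2 ^ n \<le> real (word_den u)" by (metis of_nat_le_iff of_nat_numeral of_nat_power)
  qed
  define J where "J u = cylinder (u @ [2])" for u
  have eJ: "emeasure lborel (J u) = ennreal (1 / real (word_den u * 2))" for u
    by (simp add: J_def emeasure_cylinder)
  have Jsets [measurable, simp]: "J u \<in> sets borel" for u by (simp add: J_def)
  have Jab: "J u \<subseteq> cylinder u" "approx_interval t u \<subseteq> J u" "approx_interval t u \<subseteq> {a..b}"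
    if "u \<in> W" for u
    using approx_interval_subset [OF W(2) [OF that] t] W(5) [OF that] by (auto simp: J_def)
  have disj: "disjoint_family_on cylinder W"
    using disjoint_family_cylinder by (rule disjoint_family_on_mono [rotated]) (auto simp: W_def)
  have small: "word_val u + 1 / real (word_den u) \<le> word_val u + 1 / 2 ^ n" if "u \<in> luroth_words n" for u
  proof -
    have "2 ^ n \<le> real (word_den u)"
      using mem_luroth_wordsD(3) [OF that] by (metis of_nat_le_iff of_nat_numeral of_nat_power)
    then show ?thesis by (simp add: frac_le)
  qed
  \<comment> \<open>A cylinder of order \<open>n\<close> is no longer than 2^(-n), so only points
    that close to an end of [a,b] can be missed. Hence the cylinders in \<open>W\<close> have total
    length at least l/2, and their right halves \<open>J u\<close> at least l/4.\<close>
  have "{a + 1 / 2 ^ n <..< b - 1 / 2 ^ n} \<subseteq> (\<Union>u\<in>W. cylinder u)"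
  proof
    fix x assume x: "x \<in> {a + 1 / 2 ^ n <..< b - 1 / 2 ^ n}"
    have "0 < 1 / (2::real) ^ n" by simp
    moreover have "a + 1 / 2 ^ n < x" "x < b - 1 / 2 ^ n" using x by auto
    ultimately have "a < x" "x < b" by linarith+
    then have "x \<in> {a..b}" by simp
    then have "x \<in> {0<..1}" using ab by blast
    then obtain u where u: "u \<in> luroth_words n" "x \<in> cylinder u" using UN_cylinder by blast
    have "cylinder u \<subseteq> {a..b}" using u(2) small [OF u(1)] x by (auto simp: cylinder_def)
    with u show "x \<in> (\<Union>u\<in>W. cylinder u)" by (auto simp: W_def)
  qed
  then have "emeasure lborel {a + 1 / 2 ^ n <..< b - 1 / 2 ^ n} \<le> emeasure lborel (\<Union>u\<in>W. cylinder u)"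
    using Wc by (intro emeasure_mono sets.countable_UN') auto
  also have "\<dots> = (\<integral>\<^sup>+u. emeasure lborel (cylinder u) \<partial>count_space W)"
    using disj by (intro emeasure_UN_countable) auto
  also have "\<dots> = (\<integral>\<^sup>+u. ennreal 2 * emeasure lborel (J u) \<partial>count_space W)"
    by (intro nn_integral_cong) (simp add: eJ emeasure_cylinder ennreal_mult [symmetric] del: ennreal_numeral)
  also have "\<dots> = ennreal 2 * (\<integral>\<^sup>+u. emeasure lborel (J u) \<partial>count_space W)"
    by (rule nn_integral_cmult) simp
  also have "emeasure lborel {a + 1 / 2 ^ n <..< b - 1 / 2 ^ n} = ennreal ((b - 1 / 2 ^ n) - (a + 1 / 2 ^ n))"
  proof (rule emeasure_lborel_Ioo)
    define h where "h = 1 / (2::real) ^ n"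
    have "4 * h < b - a" "0 < h" using n(2) by (simp_all add: h_def l_def)
    then show "a + 1 / 2 ^ n \<le> b - 1 / 2 ^ n" unfolding h_def [symmetric] by linarith
  qed
  also have "(b - 1 / 2 ^ n) - (a + 1 / 2 ^ n) = l - 2 / 2 ^ n" by (simp add: l_def)
  finally have "ennreal (l - 2 / 2 ^ n) \<le> ennreal 2 * (\<integral>\<^sup>+u. emeasure lborel (J u) \<partial>count_space W)" .
  moreover have "ennreal (l / 2) \<le> ennreal (l - 2 / 2 ^ n)"
  proof (rule ennreal_leI)
    have "2 / (2::real) ^ n = 2 * (1 / 2 ^ n)" by simp
    then show "l / 2 \<le> l - 2 / 2 ^ n" using n(2) by linarith
  qed
  moreover have "ennreal (l / 2) = ennreal 2 * ennreal (l / 4)"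
    using l by (simp add: ennreal_mult [symmetric] del: ennreal_numeral)
  ultimately have "ennreal 2 * ennreal (l / 4) \<le> ennreal 2 * (\<integral>\<^sup>+u. emeasure lborel (J u) \<partial>count_space W)"
    by (metis order_trans)
  then have lower: "ennreal (l / 4) \<le> (\<integral>\<^sup>+u. emeasure lborel (J u) \<partial>count_space W)"
    by (subst (asm) ennreal_mult_le_mult_iff) auto
  note found = that
  show thesis
  proof (rule ccontr)
    assume "\<not> thesis"
    have exp: "ennreal ((approx_radius t u / 200) powr s) < ball_cost c r s (approx_interval t u)"
      if "u \<in> W" for u
    proof (rule ccontr)
      assume "\<not> ?thesis"
      then have thesis
        using W(1,2) [OF that] Jab(3) [OF that] n(3) by (intro found [of u]) (auto simp: not_less)
      with \<open>\<not> thesis\<close> show False ..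
    qed
    \<comment> \<open>The summand 1 serves balls that are large compared to \<open>J u\<close>, the
      other one small balls: multiplied by the length \<open>2 * r i\<close> inside
      \<open>D i\<close>, it dominates \<open>\<epsilon> n * r i powr s\<close>.\<close>
    define F where "F i = (if cball (c i) (r i) \<inter> {a..b} = {} then 0
        else ennreal (1 + \<epsilon> n * r i powr (s - 1)))" for i
    define D where "D i = cball (c i) (3 * r i)" for i
    have \<epsilon>0: "0 \<le> \<epsilon> n" by (simp add: \<epsilon>_def)
    \<comment> \<open>A ball that is large compared to \<open>J u\<close> swallows \<open>J u\<close> in its triple \<open>D i\<close>. A small one has at
      least \<open>2 r\<close> of its triple inside \<open>J u\<close>, so it is met by boundedly many \<open>J u\<close>, for which its cost
      relative to \<open>J u\<close> is negligible because \<open>s (1 + t) < 1\<close>.\<close>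
    have pointwise: "emeasure lborel (J u) \<le> (\<Sum>i. F i * emeasure lborel (J u \<inter> D i))" if u: "u \<in> W" for u
    proof (cases "\<exists>i. cball (c i) (r i) \<inter> approx_interval t u \<noteq> {} \<and> 1 / real (word_den u * 2) \<le> 2 * r i")
      case True
      then obtain i y where y: "y \<in> cball (c i) (r i)" "y \<in> approx_interval t u"
        and i: "1 / real (word_den u * 2) \<le> 2 * r i" by blast
      have "y \<in> J u" "y \<in> {a..b}" using y(2) Jab [OF u] by auto
      have "J u \<subseteq> D i"
      proof
        fix z assume "z \<in> J u"
        with \<open>y \<in> J u\<close> have "\<bar>z - y\<bar> \<le> 2 * r i" using i by (auto simp: J_def cylinder_def)
        then show "z \<in> D i" using y(1) by (auto simp: D_def dist_real_def)
      qed
      then have "J u \<inter> D i = J u" by blast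
      moreover have "1 \<le> F i"
        using \<open>y \<in> {a..b}\<close> y(1) \<epsilon>0 by (auto simp: F_def simp flip: ennreal_1 intro!: ennreal_leI)
      ultimately have "emeasure lborel (J u) \<le> F i * emeasure lborel (J u \<inter> D i)"
        using mult_right_mono [of 1 "F i" "emeasure lborel (J u)"] by simp
      then show ?thesis by (rule order_trans) (rule le_suminf_ennreal)
    next
      case False
      define q where "q = real (word_den u * 2)"
      have "q = 2 * real (word_den u)" "0 < real (word_den u)" using W(4) [OF u] by (simp_all add: q_def)
      then have q: "2 ^ n \<le> q" "0 < q" using W(3) [OF u] by linarith+
      have rho: "approx_radius t u = q powr (- (1 + t))" by (simp add: approx_radius_def q_def)
      have "1 / q = (200 powr s * (1 / q) powr \<eta>) * (approx_radius t u / 200) powr s"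
      proof -
        have "1 / q = q powr (- 1)" using q by (simp add: powr_minus_divide)
        then have "(1 / q) powr \<eta> * approx_radius t u powr s = q powr (- 1 * \<eta> + - (1 + t) * s)"
          unfolding rho by (simp only: powr_powr powr_add)
        also have "- 1 * \<eta> + - (1 + t) * s = - 1" by (simp add: \<eta>_def algebra_simps)
        also have "q powr (- 1) = 1 / q" using q by (simp add: powr_minus_divide)
        finally show ?thesis by (simp add: powr_divide rho)
      qed
      also have "\<dots> \<le> \<epsilon> n * (approx_radius t u / 200) powr s"
        unfolding \<epsilon>_def using q \<eta> by (intro mult_right_mono mult_left_mono powr_mono2 divide_left_mono) auto
      finally have "ennreal (1 / q) \<le> ennreal (\<epsilon> n) * ennreal ((approx_radius t u / 200) powr s)"
        using \<epsilon>0 by (simp add: ennreal_mult [symmetric] ennreal_leI)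
      also have "\<dots> \<le> ennreal (\<epsilon> n) * ball_cost c r s (approx_interval t u)"
        using exp [OF u] by (intro mult_left_mono) auto
      also have "\<dots> = (\<Sum>i. ennreal (\<epsilon> n) *
          (if cball (c i) (r i) \<inter> approx_interval t u = {} then 0 else ennreal (r i powr s)))"
        by (simp add: ball_cost_def ennreal_suminf_cmult)
      also have "\<dots> \<le> (\<Sum>i. F i * emeasure lborel (J u \<inter> D i))"
      proof (intro suminf_le)
        fix i
        show "ennreal (\<epsilon> n) * (if cball (c i) (r i) \<inter> approx_interval t u = {} then 0
            else ennreal (r i powr s)) \<le> F i * emeasure lborel (J u \<inter> D i)"
        proof (cases "cball (c i) (r i) \<inter> approx_interval t u = {}")
          case ne: False
          then obtain y where y: "y \<in> cball (c i) (r i)" "y \<in> approx_interval t u" by blast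
          have yJ: "y \<in> J u" "y \<in> {a..b}" using y(2) Jab [OF u] by auto
          have "2 * r i < 1 / q" using ne False by (auto simp: q_def)
          then have "ennreal (2 * r i) \<le> emeasure lborel (J u \<inter> D i)"
            using emeasure_half_open_inter_cball_ge [of y "word_val (u @ [2])" "1 / q" "c i" "r i"] y(1) yJ(1) r [of i]
            by (simp add: J_def cylinder_def D_def q_def)
          moreover have "ennreal (\<epsilon> n * r i powr (s - 1)) \<le> F i"
            using y(1) yJ(2) by (auto simp: F_def intro!: ennreal_leI)
          ultimately have "ennreal (\<epsilon> n * r i powr (s - 1)) * ennreal (2 * r i) \<le> F i * emeasure lborel (J u \<inter> D i)"
            by (intro mult_mono) auto
          moreover have "\<epsilon> n * r i powr s \<le> \<epsilon> n * r i powr (s - 1) * (2 * r i)"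
            using r [of i] \<epsilon>0 by (simp add: powr_diff)
          ultimately show ?thesis
            using ne \<epsilon>0 r [of i] by (simp add: ennreal_mult [symmetric])
              (meson ennreal_leI order_trans)
        qed simp
      qed auto
      finally show ?thesis by (simp add: eJ q_def)
    qed
    \<comment> \<open>The cost hypothesis gives \<open>r i \<le> l / 100\<close>, so the length
      \<open>6 * r i\<close> of \<open>D i\<close> is at most
      \<open>6 * (l / 100) powr (1 - s) * r i powr s\<close>.\<close>
    have term_le: "F i * emeasure lborel (D i) \<le> ennreal (6 * (l / 100) powr (1 - s) + 6 * \<epsilon> n) *
        (if cball (c i) (r i) \<inter> {a..b} = {} then 0 else ennreal (r i powr s))" for i
    proof (cases "cball (c i) (r i) \<inter> {a..b} = {}")
      case False
      have ri: "r i \<le> l / 100"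
        using ball_cost_radius_le [where c = c and r = r and i = i, OF False, of s "l / 100"] cost s l r [of i]
        by (simp add: l_def)
      have "r i = r i powr (1 - s) * r i powr s" using r [of i] by (simp add: powr_add [symmetric])
      also have "\<dots> \<le> (l / 100) powr (1 - s) * r i powr s"
        using ri r [of i] s1 by (intro mult_right_mono powr_mono2) auto
      finally have "(1 + \<epsilon> n * r i powr (s - 1)) * (6 * r i) \<le>
          (6 * (l / 100) powr (1 - s) + 6 * \<epsilon> n) * r i powr s"
        using r [of i] by (simp add: powr_diff algebra_simps)
      moreover have "emeasure lborel (D i) = ennreal (6 * r i)"
        using r [of i] by (simp add: D_def cball_eq_atLeastAtMost)
      ultimately show ?thesis
        using False \<epsilon>0 r [of i] by (simp add: F_def ennreal_mult [symmetric] ennreal_leI del: ennreal_plus)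
    qed (simp add: F_def)
    have "(\<integral>\<^sup>+u. emeasure lborel (J u) \<partial>count_space W) \<le>
        (\<integral>\<^sup>+u. (\<Sum>i. F i * emeasure lborel (J u \<inter> D i)) \<partial>count_space W)"
      by (intro nn_integral_mono pointwise) simp
    also have "\<dots> = (\<Sum>i. \<integral>\<^sup>+u. F i * emeasure lborel (J u \<inter> D i) \<partial>count_space W)"
      by (rule nn_integral_suminf) simp
    also have "\<dots> \<le> (\<Sum>i. F i * emeasure lborel (D i))"
    proof (intro suminf_le)
      fix i
      \<comment> \<open>The pieces of \<open>D i\<close> inside the various \<open>J u\<close> are
        disjoint, so each ball is charged at most the length of \<open>D i\<close>, however many
        \<open>J u\<close> it meets.\<close>
      have "disjoint_family_on (\<lambda>u. J u \<inter> D i) W"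
        using disj Jab(1) unfolding disjoint_family_on_def by blast
      then have "(\<integral>\<^sup>+u. emeasure lborel (J u \<inter> D i) \<partial>count_space W) = emeasure lborel (\<Union>u\<in>W. J u \<inter> D i)"
        using Wc by (intro emeasure_UN_countable [symmetric]) (auto simp: D_def intro!: sets.Int)
      also have "\<dots> \<le> emeasure lborel (D i)"
        by (intro emeasure_mono) (auto simp: D_def)
      finally show "(\<integral>\<^sup>+u. F i * emeasure lborel (J u \<inter> D i) \<partial>count_space W) \<le> F i * emeasure lborel (D i)"
        by (simp add: nn_integral_cmult mult_left_mono)
    qed auto
    also have "\<dots> \<le> (\<Sum>i. ennreal (6 * (l / 100) powr (1 - s) + 6 * \<epsilon> n) *
        (if cball (c i) (r i) \<inter> {a..b} = {} then 0 else ennreal (r i powr s)))"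
      by (intro suminf_le term_le) auto
    also have "\<dots> = ennreal (6 * (l / 100) powr (1 - s) + 6 * \<epsilon> n) * ball_cost c r s {a..b}"
      by (simp add: ball_cost_def ennreal_suminf_cmult)
    also have "\<dots> \<le> ennreal (6 * (l / 100) powr (1 - s) + 6 * \<epsilon> n) * ennreal ((l / 100) powr s)"
      using cost by (intro mult_left_mono) (auto simp: l_def)
    also have "\<dots> = ennreal (6 * (l / 100) + 6 * \<epsilon> n * (l / 100) powr s)"
      using l \<epsilon>0 by (simp add: ennreal_mult [symmetric] distrib_right mult.assoc powr_add [symmetric]
          del: ennreal_plus)
    finally have "ennreal (l / 4) \<le> ennreal (6 * (l / 100) + 6 * \<epsilon> n * (l / 100) powr s)"
      using lower by (rule order_trans [rotated])
    \<comment> \<open>By the choice of \<open>n\<close> the right side is below 0.06 l + 0.1 l,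
      which contradicts 0.25 l.\<close>
    then have "l / 4 \<le> 6 * (l / 100) + 6 * \<epsilon> n * (l / 100) powr s"
      using l \<epsilon>0 by (subst (asm) ennreal_le_iff) auto
    then show False using n(1) l by linarith
  qed
qed

text \<open>A ball containing the limit point meets every interval of the descent. Each invariant
  bounds its radius by the current \<open>approx_radius\<close>, and these tend to 0, whereas
  \<open>r i > 0\<close>.\<close>

lemma luroth_approx_set_not_covered:
  assumes N0: "\<And>u m. N0 \<le> length u \<Longrightarrow> set (u @ [m]) \<subseteq> {2..} \<Longrightarrow>
      real (word_den u * m) powr (- t) < \<psi> (word_den u * m)"
    and t: "0 \<le> t" and s: "0 < s" "s * (1 + t) < 1"
    and r: "\<And>i. 0 < r i"
    and sum: "(\<Sum>i. ennreal (r i powr s)) \<le> ennreal ((approx_radius t [] / 200) powr s)"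
  shows "\<not> luroth_approx_set \<psi> \<subseteq> (\<Union>i. cball (c i) (r i))"
proof
  assume cover: "luroth_approx_set \<psi> \<subseteq> (\<Union>i. cball (c i) (r i))"
  define P where "P u \<longleftrightarrow> set u \<subseteq> {2..} \<and>
      ball_cost c r s (approx_interval t u) \<le> ennreal ((approx_radius t u / 200) powr s)" for u
  have "\<exists>f. \<forall>n. P (f n) \<and> length (f n) < length (f (Suc n)) \<and>
      approx_interval t (f (Suc n)) \<subseteq> approx_interval t (f n)"
  proof (rule dependent_nat_choice)
    \<comment> \<open>The descent starts at the empty word, where the cost is at most the sum over
      all balls; this explains the bound in \<open>sum\<close>.\<close>
    have "ball_cost c r s (approx_interval t []) \<le> (\<Sum>i. ennreal (r i powr s))"
      unfolding ball_cost_def by (intro suminf_le) auto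
    then show "\<exists>u. P u" using sum by (intro exI [of _ "[]"]) (auto simp: P_def)
  next
    fix u n assume "P u"
    then have u: "set u \<subseteq> {2..}" by (simp add: P_def)
    define a b where "a = word_val (u @ [2]) + approx_radius t u / 2"
      and "b = word_val (u @ [2]) + approx_radius t u"
    have ab: "approx_interval t u = {a..b}" "b - a = approx_radius t u / 2"
      by (simp_all add: approx_interval_def a_def b_def)
    have *: "a < b" "{a..b} \<subseteq> {0<..1}"
    proof -
      show "a < b" using approx_interval_subset(1) [OF u t] ab(2) by simp
      show "{a..b} \<subseteq> {0<..1}"
        unfolding ab(1) [symmetric]
        using approx_interval_subset(3,4) [OF u t] cylinder_subset [OF u] by (meson order_trans)
    qed
    have "ball_cost c r s {a..b} \<le> ennreal (((b - a) / 100) powr s)"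
      using \<open>P u\<close> by (simp add: P_def ab)
    from exists_cheap_approx_interval [OF r t s * this, of "Suc (length u)"]
    obtain v where "Suc (length u) \<le> length v" "set v \<subseteq> {2..}" "approx_interval t v \<subseteq> {a..b}"
      "ball_cost c r s (approx_interval t v) \<le> ennreal ((approx_radius t v / 200) powr s)" .
    then show "\<exists>v. P v \<and> length u < length v \<and> approx_interval t v \<subseteq> approx_interval t u"
      unfolding ab P_def by (intro exI [of _ v]) simp
  qed
  then obtain f where f: "\<And>n. P (f n)" "\<And>n. length (f n) < length (f (Suc n))"
    "\<And>n. approx_interval t (f (Suc n)) \<subseteq> approx_interval t (f n)" by blast
  have fw: "set (f n) \<subseteq> {2..}" for n using f(1) by (simp add: P_def)
  have len: "n \<le> length (f n)" for n
    by (induction n) (use f(2) in \<open>auto intro: Suc_leI le_less_trans\<close>)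
  have "(\<Inter>n. approx_interval t (f n)) \<noteq> {}"
  proof (rule compact_nest)
    fix n show "compact (approx_interval t (f n))" by (simp add: approx_interval_def)
    show "approx_interval t (f n) \<noteq> {}"
      using approx_interval_subset(1) [OF fw t] by (simp add: approx_interval_def less_imp_le)
  next
    fix m n :: nat assume "m \<le> n"
    then show "approx_interval t (f n) \<subseteq> approx_interval t (f m)"
      by (rule lift_Suc_antimono_le [of "\<lambda>n. approx_interval t (f n)", OF f(3)])
  qed
  then obtain x where x: "\<And>n. x \<in> approx_interval t (f n)" by auto
  have "x \<in> luroth_approx_set \<psi>"
    unfolding mem_luroth_approx_set_iff
  proof
    fix N
    define u q where "u = f (max N N0)" and "q = real (word_den u * 2)"
    have u: "set u \<subseteq> {2..}" "N \<le> length u" "N0 \<le> length u"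
      using fw len [of "max N N0"] by (auto simp: u_def)
    have xu: "x \<in> approx_interval t u" using x by (simp add: u_def)
    have q: "0 < q" using word_den_pos [OF u(1)] by (simp add: q_def)
    have "\<bar>x - word_val (u @ [2])\<bar> \<le> approx_radius t u"
      using xu approx_interval_subset(1) [OF u(1) t] by (auto simp: approx_interval_def)
    also have "approx_radius t u = q powr (- t - 1)"
      unfolding approx_radius_def q_def by (rule arg_cong [where f = "\<lambda>y. _ powr y"]) simp
    also have "\<dots> = q powr (- t) / q" using q by (simp add: powr_diff)
    \<comment> \<open>The closed interval gives only \<le>; the strict inequality in the
      approximation set comes from \<open>N0\<close>.\<close>
    also have "\<dots> < \<psi> (word_den u * 2) / q"
      using N0 [of u 2] u q unfolding q_def by (intro divide_strict_right_mono) auto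
    finally show "\<exists>u m. N \<le> length u \<and> set (u @ [m]) \<subseteq> {2..} \<and> x \<in> cylinder (u @ [m]) \<and>
        \<bar>x - word_val (u @ [m])\<bar> < \<psi> (word_den u * m) / real (word_den u * m)"
      using u xu approx_interval_subset(3) [OF u(1) t]
      by (intro exI [of _ u] exI [of _ 2]) (auto simp: q_def)
  qed
  then obtain i where i: "x \<in> cball (c i) (r i)" using cover by blast
  have ri: "r i \<le> 1 / 2 ^ n" for n
  proof -
    have "r i \<le> approx_radius t (f n) / 200"
      using i x [of n] f(1) [of n] s r [of i] approx_interval_subset(1) [OF fw t, of n]
      by (intro ball_cost_radius_le [of c i r "approx_interval t (f n)" s]) (auto simp: P_def)
    also have "\<dots> \<le> approx_radius t (f n)"
      using approx_interval_subset(1) [OF fw t, of n] by simp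
    also have "\<dots> \<le> 1 / real (word_den (f n) * 2)"
      by (rule approx_interval_subset(2) [OF fw t])
    also have "\<dots> \<le> 1 / 2 ^ n"
    proof (rule frac_le)
      have "(2::nat) ^ n \<le> 2 ^ length (f n)" using len by (intro power_increasing) auto
      also have "\<dots> \<le> word_den (f n) * 2" using word_den_ge [OF fw, of n] by simp
      finally show "2 ^ n \<le> real (word_den (f n) * 2)"
        by (metis of_nat_le_iff of_nat_numeral of_nat_power)
    qed (use word_den_pos [OF fw, of n] in auto)
    finally show ?thesis .
  qed
  have "(\<lambda>n. 1 / 2 ^ n :: real) \<longlonglongrightarrow> 0"
    using LIMSEQ_inverse_realpow_zero [of 2] by (simp add: inverse_eq_divide)
  then have "r i \<le> 0" by (rule LIMSEQ_le_const) (use ri in blast)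
  then show False using r [of i] by simp
qed

section \<open>The dimension of the approximation set\<close>

theorem theorem4:
  fixes \<psi> :: "nat \<Rightarrow> real"
  assumes "\<And>q. q \<ge> 1 \<Longrightarrow> 0 < \<psi> q \<and> \<psi> q \<le> 1"
  shows "lower_lambda \<psi> \<ge> lower_tau \<psi> \<and>
    upper_lambda \<psi> \<le> upper_tau \<psi> \<and>
    1 / (1 + upper_lambda \<psi>) \<le> hausdorff_dim (luroth_approx_set \<psi>) \<and>
    hausdorff_dim (luroth_approx_set \<psi>) \<le> 1 / (1 + lower_lambda \<psi>)"
proof (intro conjI)
  have lower0: "0 \<le> lower_lambda \<psi>" using assms by (rule lower_lambda_nonneg)
  have upper0: "0 \<le> upper_lambda \<psi>" using assms by (rule upper_lambda_nonneg)
  show "lower_tau \<psi> \<le> lower_lambda \<psi>" by (rule lower_tau_le_lower_lambda)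
  show "upper_lambda \<psi> \<le> upper_tau \<psi>" by (rule upper_lambda_le_upper_tau)
  show "1 / (1 + upper_lambda \<psi>) \<le> hausdorff_dim (luroth_approx_set \<psi>)"
    unfolding hausdorff_dim_def
  proof (rule INF_greatest)
    fix s assume "s \<in> {s. 0 \<le> s \<and> hausdorff_measure s (luroth_approx_set \<psi>) = 0}"
    then have s: "0 \<le> s" "hausdorff_measure s (luroth_approx_set \<psi>) = 0" by auto
    show "1 / (1 + upper_lambda \<psi>) \<le> ereal s"
    proof (cases "upper_lambda \<psi>")
      case (real l)
      have l: "0 \<le> l" using upper0 real by simp
      have "1 / (1 + l) \<le> s"
      proof (rule ccontr)
        assume "\<not> ?thesis"
        \<comment> \<open>Moving up to \<open>s'\<close> gives a positive exponent even if
          \<open>s = 0\<close> and leaves room for some \<open>t > l\<close> with s'(1+t) <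
          1.\<close>
        then obtain s' where s': "s < s'" "s' < 1 / (1 + l)" using dense [of s "1 / (1 + l)"] by auto
        have "0 < s'" using s s' by simp
        have "l < 1 / s' - 1" using s' l \<open>0 < s'\<close> by (simp add: field_simps)
        then obtain t where t: "l < t" "t < 1 / s' - 1" using dense by blast
        have st: "s' * (1 + t) < 1" using t \<open>0 < s'\<close> by (simp add: field_simps)
        have t0: "0 \<le> t" using l t by simp
        obtain N0 where N0: "\<And>u m. N0 \<le> length u \<Longrightarrow> set (u @ [m]) \<subseteq> {2..} \<Longrightarrow>
            real (word_den u * m) powr (- t) < \<psi> (word_den u * m)"
          using upper_lambda_lessD [of \<psi> t, OF assms] t real by auto
        have e: "0 < (approx_radius t [] / 200) powr s'" by (simp add: approx_radius_def)
        obtain r c where cr: "\<forall>i. 0 < r i" "luroth_approx_set \<psi> \<subseteq> (\<Union>i. cball (c i) (r i))"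
          "(\<Sum>i. ennreal (r i powr s')) \<le> ennreal ((approx_radius t [] / 200) powr s')"
          using hausdorff_measure_eq_0_cball_cover [OF s(2,1) less_imp_le [OF s'(1)] \<open>0 < s'\<close> e] .
        have "\<not> luroth_approx_set \<psi> \<subseteq> (\<Union>i. cball (c i) (r i))"
          using N0 t0 \<open>0 < s'\<close> st spec [OF cr(1)] cr(3) by (rule luroth_approx_set_not_covered)
        then show False using cr(2) by contradiction
      qed
      then show ?thesis using l by (simp add: real one_ereal_def)
    qed (use s upper0 in auto)
  qed
  \<comment> \<open>The case \<open>t = 0\<close> needs only \<psi> \<le> 1. It is separate because
    for \<open>lower_lambda \<psi> = 0\<close> no \<open>t \<ge> 0\<close> lies strictly below the
    exponent.\<close>
  have upper: "hausdorff_dim (luroth_approx_set \<psi>) \<le> ereal s"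
    if "0 \<le> t" "1 < s * (1 + t)" "t = 0 \<or> ereal t < lower_lambda \<psi>" for s t
  proof -
    have "\<exists>N. \<forall>u m. N \<le> length u \<longrightarrow> set (u @ [m]) \<subseteq> {2..} \<longrightarrow>
        \<psi> (word_den u * m) \<le> real (word_den u * m) powr (- t)"
      using that(3)
    proof
      assume "t = 0"
      have "\<psi> (word_den u * m) \<le> real (word_den u * m) powr (- t)"
        if "set (u @ [m]) \<subseteq> {2..}" for u m
      proof -
        have "1 \<le> word_den u * m" using that word_den_pos [of u] by (simp add: Suc_le_eq)
        then show ?thesis using assms [of "word_den u * m"] \<open>t = 0\<close> by simp
      qed
      then show ?thesis by blast
    next
      assume "ereal t < lower_lambda \<psi>"
      then obtain N where "\<And>u m. N \<le> length u \<Longrightarrow> set (u @ [m]) \<subseteq> {2..} \<Longrightarrow>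
          \<psi> (word_den u * m) \<le> real (word_den u * m) powr (- t)"
        using less_lower_lambdaD [of \<psi> t, OF assms] by auto
      then show ?thesis by blast
    qed
    then obtain N where "\<And>u m. N \<le> length u \<Longrightarrow> set (u @ [m]) \<subseteq> {2..} \<Longrightarrow>
        \<psi> (word_den u * m) \<le> real (word_den u * m) powr (- t)" by blast
    then have "hausdorff_measure s (luroth_approx_set \<psi>) = 0"
      using that(1,2) by (rule hausdorff_measure_luroth_approx_set_eq_0)
    moreover have "0 \<le> s" using that(1,2) by (smt (verit) mult_nonpos_nonneg)
    ultimately show ?thesis unfolding hausdorff_dim_def by (intro INF_lower) simp
  qed
  show "hausdorff_dim (luroth_approx_set \<psi>) \<le> 1 / (1 + lower_lambda \<psi>)"
  proof (rule dense_ge)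
    fix z assume z: "1 / (1 + lower_lambda \<psi>) < z"
    show "hausdorff_dim (luroth_approx_set \<psi>) \<le> z"
    proof (cases z)
      case (real s)
      show ?thesis
      proof (cases "lower_lambda \<psi>")
        case (real l)
        then have l: "0 \<le> l" using lower0 by simp
        have s: "1 / (1 + l) < s" using z l real \<open>z = ereal s\<close> by (simp add: one_ereal_def)
        moreover have "0 < 1 / (1 + l)" using l by simp
        ultimately have "0 < s" by linarith
        show ?thesis
        proof (cases "l = 0")
          case True
          then show ?thesis using upper [of 0 s] s \<open>z = ereal s\<close> by simp
        next
          case False
          have "1 / s - 1 < l" using s l \<open>0 < s\<close> by (simp add: field_simps)
          then obtain t where t: "max 0 (1 / s - 1) < t" "t < l"
            using dense [of "max 0 (1 / s - 1)" l] l False by auto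
          then have "1 < s * (1 + t)" using \<open>0 < s\<close> by (simp add: field_simps)
          then show ?thesis using upper [of t s] t real \<open>z = ereal s\<close> by simp
        qed
      next
        case PInf
        then have "0 < s" using z \<open>z = ereal s\<close> by simp
        \<comment> \<open>For an infinite exponent every \<open>t\<close> is allowed;
          \<open>t = 1 / s\<close> gives s + 1 > 1, so every positive \<open>s\<close> bounds the
          dimension.\<close>
        then have "1 < s * (1 + 1 / s)" by (simp add: field_simps)
        then show ?thesis using upper [of "1 / s" s] PInf \<open>0 < s\<close> \<open>z = ereal s\<close> by simp
      qed (use lower0 in auto)
    next
      case MInf
      then show ?thesis using z by simp
    qed simp
  qed
qed

end
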